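(* Let $d\ge 2$, let $D\subset[0,1]^d$ be a strictly convex open set with $\overline D\subset(0,1)^d$, and let $f\colon [0,1]^d\setminus D\to\mathbb{R}$ be continuous. Let $(r_n)$ be a sequence of positive numbers decreasing to $0$ such that $$\frac{\sqrt{n}\, r_n^{2d}}{\log n}\longrightarrow +\infty\quad (n\to\infty),\qquad \text{and let}\quad \delta_n=\frac{r_n}{\sqrt{\log n}} .$$ Let $u\colon D\to\mathbb{R}$ be the unique viscosity solution of $$\begin{cases}-\lambda_1[D^2u](x)=0, & x\in D,\\ u(x)=f(x), & x\in\partial D,\end{cases}$$ where the boundary datum is attained continuously. Then, $\mathbb{P}$-almost surely, the sequence of (extended) game values $\tilde u_n\colon D\to\mathbb{R}$ converges to $u$ uniformly on $D$ as $n\to\infty$.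
   Context: For a symmetric matrix $M$, $\lambda_1[M]=\min_{|z|=1}\langle Mz,z\rangle$ is its smallest eigenvalue. (The viscosity solution $u$ is the convex envelope of $f|_{\partial D}$ in $D$.) Random graph. $(X_n)_{n\in\mathbb{N}}$ are independent random variables uniform on $[0,1]^d$; $\mathbb{P}$ is the product measure on $\Omega=([0,1]^d)^{\mathbb{N}}$. Set $\chi_n=\{X_1,\dots,X_n\}$. The graph $\mathcal{G}_n$ has vertex set $\chi_n$, and distinct $x,y\in\chi_n$ are adjacent ($x\sim y$) iff $|x-y|<r_n$ (Euclidean norm). $\mathcal{C}_n$ denotes the largest connected component of $\mathcal{G}_n$ (its vertex set), $\mathcal{D}_n=\mathcal{C}_n\cap D$, $\mathcal{B}_n=\mathcal{C}_n\cap([0,1]^d\setminus D)$. For $x\in\chi_n$, $\mathcal{N}_x=\{y\in\chi_n: y\sim x\}$ and $\mathcal{N}_x^{\delta_n}=\{y\in\mathcal{N}_x: |x-y|>(1-\delta_n)r_n\}$. When $\mathcal{N}_x^{\delta_n}\ne\emptyset$ and $y\in\mathcal{N}_x^{\delta_n}$, the approximate reflection of $y$ with respect to $x$ is $y_x=A_x(y)=\operatorname{argmin}\{|z+y-2x|^2: z\in\mathcal{N}_x^{\delta_n}\}$ (ties, of probability zero, are broken by lexicographic order). $\mathbb{P}$-almost surely, for $n$ large, $\mathcal{N}_x^{\delta_n}\neq\emptyset$ for all $x\in\mathcal{C}_n$, so that the game below is well defined. Game (for a fixed realization of the graph). A strategy $S=(S_n^k)_{k\ge0}$ assigns to each partial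 history $(x_0,\dots,x_k)$ of positions a point $S_n^k(x_0,\dots,x_k)\in\mathcal{N}_{x_k}^{\delta_n}$. Given $x_0$ and $S$, $P_{S,n}^{x_0}$ is the law of the sequence of positions started at $x_0$ such that, conditionally on $(x_0,\dots,x_k)$, the next position $x_{k+1}$ equals $S_n^k(x_0,\dots,x_k)$ with probability $1/2$ and $A_{x_k}(S_n^k(x_0,\dots,x_k))$ with probability $1/2$; $E_{S,n}^{x_0}$ is the corresponding expectation. Let $\tau=\inf\{k\ge0: x_k\in\mathcal{B}_n\}$. The game value is $u_n(x_0)=\inf_S E_{S,n}^{x_0}[f(x_\tau)]$, $x_0\in\mathcal{C}_n$, where the infimum is over all strategies; for $x_0\in\mathcal{B}_n$ one has $\tau=0$ and $u_n(x_0)=f(x_0)$. ($\mathbb{P}$-almost surely, for $n$ large, $\tau<\infty$ $P_{S,n}^{x_0}$-almost surely for every $x_0$ and $S$.) Extension. $T_n\colon D\to\chi_n$ maps $x$ to the point of $\chi_n$ closest to $x$ (ties broken by a fixed rule, e.g. lexicographic order), and $\tilde u_n(x)=u_n(T_n(x))$ for $x\in D$. (In this regime, almost surely $\mathcal{G}_n$ is connected, i.e. $\mathcal{C}_n=\chi_n$, for $n$ large, so $\tilde u_n$ is well defined for $n$ large.) *)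

theory Defs
  imports "HOL-Probability.Probability"
begin

section \<open>The convex envelope problem\<close>

text \<open>Strict convexity is a condition on segments between points of the closure; for an open set
  the open segments have to lie in the set itself.\<close>

definition strictly_convex_open :: "'a::real_normed_vector set \<Rightarrow> bool" where
  "strictly_convex_open D \<longleftrightarrow>
     open D \<and> (\<forall>x\<in>closure D. \<forall>y\<in>closure D. x \<noteq> y \<longrightarrow> open_segment x y \<subseteq> D)"

definition lambda1 :: "real^'n^'n \<Rightarrow> real" where
  "lambda1 M = (INF z\<in>sphere 0 1. (M *v z) \<bullet> z)"

text \<open>\<open>C2_on U \<phi> H\<close>: the function \<open>\<phi>\<close> is twice continuously differentiable on the open set \<open>U\<close>,
  with Hessian \<open>H\<close>.\<close>

definition C2_on :: "(real^'n) set \<Rightarrow> (real^'n \<Rightarrow> real) \<Rightarrow> (real^'n \<Rightarrow> real^'n^'n) \<Rightarrow> bool" where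
  "C2_on U \<phi> H \<longleftrightarrow>
     (\<exists>g. (\<forall>x\<in>U. (\<phi> has_derivative (\<lambda>h. g x \<bullet> h)) (at x)) \<and>
          (\<forall>x\<in>U. (g has_derivative (\<lambda>h. H x *v h)) (at x)) \<and>
          continuous_on U H)"

definition viscosity_subsolution :: "(real^'n) set \<Rightarrow> (real^'n \<Rightarrow> real) \<Rightarrow> bool" where
  "viscosity_subsolution D u \<longleftrightarrow>
     (\<forall>x\<in>D. \<forall>\<phi> H. C2_on D \<phi> H \<and> (\<forall>\<^sub>F y in at x. u y - \<phi> y \<le> u x - \<phi> x)
        \<longrightarrow> - lambda1 (H x) \<le> 0)"

definition viscosity_supersolution :: "(real^'n) set \<Rightarrow> (real^'n \<Rightarrow> real) \<Rightarrow> bool" where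
  "viscosity_supersolution D u \<longleftrightarrow>
     (\<forall>x\<in>D. \<forall>\<phi> H. C2_on D \<phi> H \<and> (\<forall>\<^sub>F y in at x. u y - \<phi> y \<ge> u x - \<phi> x)
        \<longrightarrow> - lambda1 (H x) \<ge> 0)"

definition viscosity_solution ::
  "(real^'n) set \<Rightarrow> (real^'n \<Rightarrow> real) \<Rightarrow> (real^'n \<Rightarrow> real) \<Rightarrow> bool" where
  "viscosity_solution D f u \<longleftrightarrow>
     continuous_on D u \<and> viscosity_subsolution D u \<and> viscosity_supersolution D u \<and>
     (\<forall>x\<in>frontier D. (u \<longlongrightarrow> f x) (at x within D))"

section \<open>Lexicographic tie-breaking\<close>

definition lex_le :: "real^'n::{finite,linorder} \<Rightarrow> real^'n::_ \<Rightarrow> bool" where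
  "lex_le x y \<longleftrightarrow> x = y \<or> (\<exists>i. x $ i < y $ i \<and> (\<forall>j<i. x $ j = y $ j))"

text \<open>The lexicographically smallest of the minimisers of \<open>g\<close> on \<open>A\<close>; meaningful for finite
  nonempty \<open>A\<close>.\<close>

definition lex_argmin ::
  "(real^'n::{finite,linorder} \<Rightarrow> real) \<Rightarrow> (real^'n::_) set \<Rightarrow> real^'n::_" where
  "lex_argmin g A =
     (THE z. is_arg_min g (\<lambda>z. z \<in> A) z \<and> (\<forall>w. is_arg_min g (\<lambda>z. z \<in> A) w \<longrightarrow> lex_le z w))"

section \<open>The random geometric graph\<close>

definition sample_space :: "(nat \<Rightarrow> real^'n) measure" where
  "sample_space = PiM UNIV (\<lambda>_. uniform_measure lborel (cbox 0 1))"

definition vertices :: "(nat \<Rightarrow> real^'n) \<Rightarrow> nat \<Rightarrow> (real^'n) set" where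
  "vertices X n = X ` {1..n}"

definition nbrs :: "(real^'n) set \<Rightarrow> real \<Rightarrow> real^'n \<Rightarrow> (real^'n) set" where
  "nbrs V r x = {y\<in>V. y \<noteq> x \<and> norm (x - y) < r}"

definition component :: "(real^'n) set \<Rightarrow> real \<Rightarrow> real^'n \<Rightarrow> (real^'n) set" where
  "component V r x = {y. (x, y) \<in> {(a, b). a \<in> V \<and> b \<in> nbrs V r a}\<^sup>*}"

text \<open>If several components have maximal cardinality, we take the one that contains the
  lexicographically smallest vertex of their union.\<close>

definition largest_component :: "(real^'n::{finite,linorder}) set \<Rightarrow> real \<Rightarrow> (real^'n::_) set" where
  "largest_component V r = component V r (lex_argmin (\<lambda>x. - real (card (component V r x))) V)"

definition outer_nbrs :: "(real^'n) set \<Rightarrow> real \<Rightarrow> real \<Rightarrow> real^'n \<Rightarrow> (real^'n) set" where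
  "outer_nbrs V r \<delta> x = {y\<in>nbrs V r x. norm (x - y) > (1 - \<delta>) * r}"

definition reflection ::
  "(real^'n::{finite,linorder}) set \<Rightarrow> real \<Rightarrow> real \<Rightarrow> real^'n::_ \<Rightarrow> real^'n::_ \<Rightarrow> real^'n::_" where
  "reflection V r \<delta> x y = lex_argmin (\<lambda>z. (norm (z + y - 2 *\<^sub>R x))\<^sup>2) (outer_nbrs V r \<delta> x)"

section \<open>The game\<close>

text \<open>A strategy maps the list \<open>[x\<^sub>0, \<dots>, x\<^sub>k]\<close> of the positions so far to the chosen neighbour of
  \<open>x\<^sub>k\<close>.\<close>

definition strategies ::
  "(real^'n::{finite,linorder}) set \<Rightarrow> real \<Rightarrow> real \<Rightarrow> ((real^'n::_) list \<Rightarrow> real^'n::_) set" where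
  "strategies V r \<delta> =
     {S. \<forall>h. h \<noteq> [] \<and> set h \<subseteq> largest_component V r \<longrightarrow> S h \<in> outer_nbrs V r \<delta> (last h)}"

text \<open>The history up to round \<open>k\<close>, when the outcomes of the coin tosses are given by \<open>c\<close>.\<close>

primrec history ::
  "(real^'n::{finite,linorder}) set \<Rightarrow> real \<Rightarrow> real \<Rightarrow> ((real^'n::_) list \<Rightarrow> real^'n::_) \<Rightarrow> real^'n::_ \<Rightarrow>
     (nat \<Rightarrow> bool) \<Rightarrow> nat \<Rightarrow> (real^'n::_) list" where
  "history V r \<delta> S x0 c 0 = [x0]"
| "history V r \<delta> S x0 c (Suc k) =
     (let h = history V r \<delta> S x0 c k
      in h @ [if c k then S h else reflection V r \<delta> (last h) (S h)])"

text \<open>The law of the sequence of positions is the image of the law of a sequence of independent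
  fair coins.\<close>

definition game_law ::
  "(real^'n::{finite,linorder}) set \<Rightarrow> real \<Rightarrow> real \<Rightarrow> ((real^'n::_) list \<Rightarrow> real^'n::_) \<Rightarrow> real^'n::_ \<Rightarrow>
     (nat \<Rightarrow> real^'n::_) measure" where
  "game_law V r \<delta> S x0 =
     distr (PiM UNIV (\<lambda>_. measure_pmf (bernoulli_pmf (1/2)))) (PiM UNIV (\<lambda>_. borel))
       (\<lambda>c k. last (history V r \<delta> S x0 c k))"

text \<open>The payoff \<open>f (x\<^sub>\<tau>)\<close>, where \<open>\<tau>\<close> is the hitting time of \<open>B\<close>. The value \<open>0\<close> on \<open>\<tau> = \<infinity>\<close> makes the
  payoff measurable for finite \<open>B\<close> and arbitrary \<open>f\<close>.\<close>

definition payoff :: "(real^'n) set \<Rightarrow> (real^'n \<Rightarrow> real) \<Rightarrow> (nat \<Rightarrow> real^'n) \<Rightarrow> real" where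
  "payoff B f x = (if \<exists>k. x k \<in> B then f (x (LEAST k. x k \<in> B)) else 0)"

definition boundary_vertices ::
  "(real^'n::{finite,linorder}) set \<Rightarrow> (real^'n::_) set \<Rightarrow> real \<Rightarrow> (real^'n::_) set" where
  "boundary_vertices D V r = largest_component V r \<inter> (cbox 0 1 - D)"

definition game_value ::
  "(real^'n::{finite,linorder}) set \<Rightarrow> (real^'n::_ \<Rightarrow> real) \<Rightarrow> (real^'n::_) set \<Rightarrow> real \<Rightarrow> real \<Rightarrow>
     real^'n::_ \<Rightarrow> real" where
  "game_value D f V r \<delta> x0 =
     (INF S\<in>strategies V r \<delta>. integral\<^sup>L (game_law V r \<delta> S x0) (payoff (boundary_vertices D V r) f))"

definition closest_vertex :: "(real^'n::{finite,linorder}) set \<Rightarrow> real^'n::_ \<Rightarrow> real^'n::_" where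
  "closest_vertex V x = lex_argmin (\<lambda>z. norm (x - z)) V"

definition extended_value ::
  "(real^'n::{finite,linorder}) set \<Rightarrow> (real^'n::_ \<Rightarrow> real) \<Rightarrow> (real^'n::_) set \<Rightarrow> real \<Rightarrow> real \<Rightarrow>
     real^'n::_ \<Rightarrow> real" where
  "extended_value D f V r \<delta> x = game_value D f V r \<delta> (closest_vertex V x)"

end

theory Submission
  imports Defs
begin

text \<open>Almost surely, for large \<open>n\<close>, the points are so dense in the cube that the reflection of \<open>y\<close>
  at \<open>x\<close> is \<open>2x - y\<close> up to an error \<open>\<epsilon>\<^sub>n\<close> with \<open>\<epsilon>\<^sub>n = o(r\<^sub>n\<^sup>2)\<close>. The function \<open>u\<close> is
  convex, and through every interior point there is a segment on which it is affine. After a slight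
  dilation \<open>u\<close> becomes a function \<open>g\<close> that is Lipschitz near \<open>D\<close> and has such segments of uniform
  length. Then \<open>g(x) + 2\<kappa> - \<eta> |x|\<^sup>2\<close> and \<open>g(x) - 2\<kappa> + \<eta> |x|\<^sup>2\<close> are strict discrete super- and
  subsolutions of the game: one step changes \<open>\<eta> |x|\<^sup>2\<close> by about \<open>\<eta> r\<^sub>n\<^sup>2\<close>, which dominates the
  Lipschitz error of order \<open>\<epsilon>\<^sub>n\<close>. The super- and submartingales obtained along the game bound its value.\<close>

section \<open>Dense vertex sets\<close>

text \<open>The tolerance \<open>\<kappa>\<close> is fixed before \<open>n\<close>, and the argument
  rests on this order: the Lipschitz constant \<open>L\<close> of \<open>g\<close> may blow up as
  \<open>\<kappa>\<close> tends to 0, but for fixed \<open>L\<close> the error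
  \<open>L * \<epsilon>\<close> is eventually small against \<open>\<kappa> * r\<^sup>2\<close>.
  Randomness enters only through the density of the vertices; the rest is deterministic, so one
  almost sure event serves all tolerances. The two halves of the viscosity condition serve the two
  bounds. The subsolution property makes \<open>u\<close> convex, so that no pair of nearly opposite
  moves lowers the expected value noticeably; this bounds every strategy from below. The
  supersolution property yields flat segments, and following them is one strategy that is nearly
  optimal. The quadratic perturbation has a second use: it gives the comparison process a drift of
  at least \<open>a\<close> at every step inside \<open>D\<close>. The probability of surviving
  \<open>k\<close> rounds is therefore of order \<open>1 / k\<close>, which proves at once that the
  game terminates and that stopping at the random time is legitimate.\<close>

lemma lex_le_total:
  fixes x y :: "real^'n::{finite,linorder}"
  shows "lex_le x y \<or> lex_le y x"
proof (cases "x = y")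
  case False
  define I where "I = {i. x $ i \<noteq> y $ i}"
  have "I \<noteq> {}" using False by (auto simp: I_def vec_eq_iff)
  then have "Min I \<in> I" by (intro Min_in) auto
  moreover have "x $ j = y $ j" if "j < Min I" for j
  proof -
    have "j \<notin> I" using that Min_le[of I j] by (meson finite leD)
    then show ?thesis by (simp add: I_def)
  qed
  ultimately show ?thesis
    unfolding lex_le_def I_def by (metis (mono_tags, lifting) linorder_neqE_linordered_idom mem_Collect_eq)
qed (simp add: lex_le_def)

lemma lex_le_antisym:
  fixes x y :: "real^'n::{finite,linorder}"
  assumes "lex_le x y" "lex_le y x"
  shows "x = y"
  using assms unfolding lex_le_def by (metis less_asym linorder_neqE order_less_irrefl)

lemma lex_le_trans:
  fixes x y z :: "real^'n::{finite,linorder}"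
  assumes "lex_le x y" "lex_le y z"
  shows "lex_le x z"
proof (cases "x = y \<or> y = z")
  case False
  then obtain i j where i: "x $ i < y $ i" "\<forall>k<i. x $ k = y $ k"
    and j: "y $ j < z $ j" "\<forall>k<j. y $ k = z $ k"
    using assms unfolding lex_le_def by blast
  have "x $ min i j < z $ min i j" 
    using i j by (cases i j rule: linorder_cases) (auto simp: min_def)
  moreover have "\<forall>k<min i j. x $ k = z $ k"
    using i j by auto
  ultimately show ?thesis unfolding lex_le_def by blast
qed (use assms in auto)

lemma finite_has_lex_least:
  fixes A :: "(real^'n::{finite,linorder}) set"
  assumes "finite A" "A \<noteq> {}"
  shows "\<exists>z\<in>A. \<forall>w\<in>A. lex_le z w"
  using assms
proof (induction A rule: finite_ne_induct)
  case (singleton x)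
  then show ?case by (auto simp: lex_le_def)
next
  case (insert x F)
  then obtain z where z: "z \<in> F" "\<forall>w\<in>F. lex_le z w" by blast
  show ?case
  proof (cases "lex_le x z")
    case True
    then have "\<forall>w\<in>insert x F. lex_le x w"
      using z lex_le_trans[of x z] by (auto simp: lex_le_def[of x x])
    then show ?thesis by blast
  next
    case False
    then show ?thesis using z lex_le_total[of x z] by blast
  qed
qed

text \<open>Makes the definite description in \<open>lex_argmin\<close> meaningful: the minimisers
  form a finite nonempty set, whose lexicographically least element is unique by
  \<open>lex_le_antisym\<close>.\<close>

lemma is_arg_min_lex_argmin:
  fixes A :: "(real^'n::{finite,linorder}) set"
  assumes "finite A" "A \<noteq> {}"
  shows "is_arg_min g (\<lambda>z. z \<in> A) (lex_argmin g A)"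
proof -
  define M where "M = {z. is_arg_min g (\<lambda>z. z \<in> A) z}"
  have "M \<subseteq> A" by (auto simp: M_def is_arg_min_def)
  moreover have "M \<noteq> {}"
    using ex_is_arg_min_if_finite[OF assms, of g] by (auto simp: M_def)
  ultimately obtain z where z: "z \<in> M" "\<forall>w\<in>M. lex_le z w"
    using finite_has_lex_least[of M] finite_subset assms(1) by blast
  have "lex_argmin g A = z"
    unfolding lex_argmin_def
    by (rule the_equality) (use z lex_le_antisym in \<open>auto simp: M_def\<close>)
  then show ?thesis using z by (simp add: M_def)
qed

lemma lex_argmin_in:
  fixes A :: "(real^'n::{finite,linorder}) set"
  assumes "finite A" "A \<noteq> {}"
  shows "lex_argmin g A \<in> A"
  using is_arg_min_lex_argmin[OF assms, of g] by (simp add: is_arg_min_def)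

lemma lex_argmin_le:
  fixes A :: "(real^'n::{finite,linorder}) set"
  assumes "finite A" "z \<in> A"
  shows "g (lex_argmin g A) \<le> g z"
proof -
  have "A \<noteq> {}" using assms(2) by blast
  from is_arg_min_lex_argmin[OF assms(1) this, of g] assms(2)
  show ?thesis by (auto simp: is_arg_min_linorder)
qed

text \<open>The interface between probability and game: all later facts about the graph follow from
  this property and from inequalities between \<open>\<epsilon>\<close>, \<open>\<delta>\<close> and
  \<open>r\<close>.\<close>

definition eps_dense :: "real \<Rightarrow> (real^'n) set \<Rightarrow> bool" where
  "eps_dense \<epsilon> V \<longleftrightarrow> finite V \<and> V \<subseteq> cbox 0 1 \<and> (\<forall>p\<in>cbox 0 1. \<exists>v\<in>V. norm (v - p) \<le> \<epsilon>)"

lemma eps_dense_near: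
  assumes "eps_dense \<epsilon> V" "p \<in> cbox 0 1"
  obtains v where "v \<in> V" "norm (v - p) \<le> \<epsilon>"
  using assms unfolding eps_dense_def by blast

lemma eps_dense_ne:
  assumes "eps_dense \<epsilon> V" shows "V \<noteq> {}"
  using eps_dense_near[OF assms, of 0] by (force simp: mem_box_cart)

lemma closest_vertex_near:
  fixes x :: "real^'n::{finite,linorder}"
  assumes "eps_dense \<epsilon> V" "x \<in> cbox 0 1"
  shows "closest_vertex V x \<in> V" "norm (closest_vertex V x - x) \<le> \<epsilon>"
proof -
  have fin: "finite V" using assms by (simp add: eps_dense_def)
  show "closest_vertex V x \<in> V"
    unfolding closest_vertex_def using lex_argmin_in[OF fin eps_dense_ne[OF assms(1)]] .
  obtain v where v: "v \<in> V" "norm (v - x) \<le> \<epsilon>" using eps_dense_near[OF assms] .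
  have "norm (x - closest_vertex V x) \<le> norm (x - v)"
    unfolding closest_vertex_def by (rule lex_argmin_le[OF fin v(1)])
  then show "norm (closest_vertex V x - x) \<le> \<epsilon>" using v(2) by (simp add: norm_minus_commute)
qed

text \<open>Divide the segment from \<open>x\<close> to another vertex into pieces shorter than
  \<open>r / 4\<close> and choose a vertex within \<open>\<epsilon>\<close> of each division point;
  these points stay in the cube by convexity. Consecutive choices are at distance less than
  \<open>2 * \<epsilon> + r / 4 < r\<close>, hence equal or adjacent.\<close>

lemma component_eps_dense:
  fixes x :: "real^'n"
  assumes V: "eps_dense \<epsilon> V" and \<epsilon>: "4 * \<epsilon> \<le> r" "0 < r" and x: "x \<in> V"
  shows "component V r x = V"
proof
  let ?E = "{(a, b). a \<in> V \<and> b \<in> nbrs V r a}"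
  show "component V r x \<subseteq> V"
  proof
    fix y assume "y \<in> component V r x"
    then have "(x, y) \<in> ?E\<^sup>*" by (simp add: component_def)
    then show "y \<in> V" by (induction rule: rtrancl_induct) (use x in \<open>auto simp: nbrs_def\<close>)
  qed
  have VC: "V \<subseteq> cbox 0 1" using V by (simp add: eps_dense_def)
  have step: "(a, b) \<in> ?E\<^sup>*" if "a \<in> V" "b \<in> V" "norm (a - b) < r" for a b
    using that by (cases "a = b") (auto simp: nbrs_def)
  show "V \<subseteq> component V r x"
  proof
    fix y assume y: "y \<in> V"
    obtain N :: nat where N: "4 * norm (y - x) / r < real N" "N > 0"
      proof -
      obtain M :: nat where "4 * norm (y - x) / r < real M" using reals_Archimedean2 by blast
      then show thesis using that[of "Suc M"] by simp
    qed
    define p where "p k = x + (real k / real N) *\<^sub>R (y - x)" for k :: nat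
    have pC: "p k \<in> cbox 0 1" if "k \<le> N" for k
    proof -
      have "p k = (1 - real k / real N) *\<^sub>R x + (real k / real N) *\<^sub>R y"
        by (simp add: p_def algebra_simps)
      also have "\<dots> \<in> cbox 0 1"
        using x y VC that N by (intro convexD[OF convex_box(1)]) auto
      finally show ?thesis .
    qed
    have pp: "norm (p (Suc k) - p k) < r / 4" for k
    proof -
      have "p (Suc k) - p k = (1 / real N) *\<^sub>R (y - x)"
        unfolding p_def by (simp add: add_divide_distrib scaleR_left_distrib)
      then have "norm (p (Suc k) - p k) = norm (y - x) / real N" by simp
      moreover have "norm (y - x) / real N < r / 4"
        using N \<epsilon> by (simp add: field_simps)
      ultimately show ?thesis by simp
    qed
    have "\<exists>v\<in>V. norm (v - p k) \<le> \<epsilon> \<and> (x, v) \<in> ?E\<^sup>*" if "k \<le> N" for k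
      using that
    proof (induction k)
      case 0
      have "0 \<le> \<epsilon>" using eps_dense_near[OF V, of 0] norm_ge_zero
        by (metis order_trans VC x subsetD eps_dense_near[OF V])
      then show ?case using x by (intro bexI[of _ x]) (auto simp: p_def)
    next
      case (Suc k)
      then obtain v where v: "v \<in> V" "norm (v - p k) \<le> \<epsilon>" "(x, v) \<in> ?E\<^sup>*" by auto
      obtain w where w: "w \<in> V" "norm (w - p (Suc k)) \<le> \<epsilon>"
        using eps_dense_near[OF V pC[OF Suc.prems]] .
      have "norm (v - w) < r"
        using v(2) w(2) pp[of k] \<epsilon> by norm
      then have "(v, w) \<in> ?E\<^sup>*" using step v w by blast
      then show ?case using v w by (meson rtrancl_trans)
    qed
    from this[of N] obtain v where v: "v \<in> V" "norm (v - p N) \<le> \<epsilon>" "(x, v) \<in> ?E\<^sup>*" by auto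
    have "p N = y" using N by (simp add: p_def)
    then have "norm (v - y) < r" using v(2) \<epsilon> by simp
    then have "(x, y) \<in> ?E\<^sup>*" using step[OF v(1) y] v(3) by (meson rtrancl_trans)
    then show "y \<in> component V r x" by (simp add: component_def)
  qed
qed

lemma largest_component_eps_dense:
  fixes V :: "(real^'n::{finite,linorder}) set"
  assumes "eps_dense \<epsilon> V" "4 * \<epsilon> \<le> r" "0 < r"
  shows "largest_component V r = V"
proof -
  have "finite V" using assms by (simp add: eps_dense_def)
  then show ?thesis unfolding largest_component_def
    using component_eps_dense[OF assms lex_argmin_in[OF _ eps_dense_ne[OF assms(1)]]] by blast
qed

text \<open>A vertex close to \<open>p\<close> could fall just outside the annulus. Therefore
  \<open>p\<close> is first moved along the ray from \<open>x\<close>, by at most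
  \<open>2 * \<epsilon>\<close>, to a point \<open>q\<close> with a margin to both edges; a vertex
  within \<open>\<epsilon>\<close> of \<open>q\<close> is then an outer neighbour. The last
  hypothesis keeps \<open>q\<close> inside the cube.\<close>

lemma outer_nbrs_near:
  fixes x p :: "real^'n"
  assumes V: "eps_dense \<epsilon> V" and w: "4 * \<epsilon> \<le> \<delta> * r" "\<delta> \<le> 1/2" "0 < \<epsilon>" "0 < r"
    and p: "(1 - \<delta>) * r \<le> norm (p - x)" "norm (p - x) \<le> r"
    and C: "\<And>t. 0 \<le> t \<Longrightarrow> t \<le> r \<Longrightarrow> x + (t / norm (p - x)) *\<^sub>R (p - x) \<in> cbox 0 1"
  obtains v where "v \<in> outer_nbrs V r \<delta> x" "norm (v - p) \<le> 3 * \<epsilon>"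
proof -
  define a where "a = norm (p - x)"
  have "r / 2 \<le> (1 - \<delta>) * r" using w by (simp add: field_simps)
  then have a0: "a > 0" using p w unfolding a_def by linarith
  define l where "l = (1 - \<delta>) * r"
  \<comment> \<open>The distance \<open>a\<close>, clamped to the annulus shrunk by
    \<open>2 * \<epsilon>\<close> at both edges; \<open>4 * \<epsilon> \<le> \<delta> * r\<close>
    leaves this interval nonempty.\<close>
  define t where "t = min (max a ((1 - \<delta>) * r + 2 * \<epsilon>)) (r - 2 * \<epsilon>)"
  have le: "(1 - \<delta>) * r + 2 * \<epsilon> \<le> r - 2 * \<epsilon>" using w by (simp add: algebra_simps)
  have t: "(1 - \<delta>) * r + 2 * \<epsilon> \<le> t" "t \<le> r - 2 * \<epsilon>" "\<bar>t - a\<bar> \<le> 2 * \<epsilon>"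
    using le p w(3) unfolding t_def a_def by (auto simp: min_def max_def abs_if)
  have t0: "0 \<le> t" "t \<le> r" using t \<open>r / 2 \<le> (1 - \<delta>) * r\<close> w by linarith+
  define q where "q = x + (t / a) *\<^sub>R (p - x)"
  have "q \<in> cbox 0 1" using C[OF t0] by (simp add: q_def a_def)
  then obtain v where v: "v \<in> V" "norm (v - q) \<le> \<epsilon>" using eps_dense_near[OF V] by blast
  have qx: "norm (q - x) = t" using a0 t0 by (simp add: q_def a_def)
  have "q - p = ((t - a) / a) *\<^sub>R (p - x)"
  proof -
    have e: "(t - a) / a = t / a - 1" using a0 by (simp add: field_simps)
    show ?thesis unfolding e by (simp add: q_def algebra_simps)
  qed
  then have "norm (q - p) = \<bar>t - a\<bar>" using a0 by (simp add: a_def)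
  then have qp: "norm (q - p) \<le> 2 * \<epsilon>" using t by simp
  have tri: "norm (v - p) \<le> norm (v - q) + norm (q - p)"
    "norm (x - v) \<le> norm (q - x) + norm (v - q)" "norm (q - x) \<le> norm (x - v) + norm (v - q)"
    by norm+
  have "norm (v - p) \<le> 3 * \<epsilon>" using v(2) qp tri by linarith
  moreover have "norm (x - v) < r" using v(2) qx t(2) w(3) tri by linarith
  moreover have "l < norm (x - v)" using v(2) qx t(1) w(3) tri unfolding l_def[symmetric] by linarith
  moreover have "v \<noteq> x" using calculation(3) \<open>r / 2 \<le> (1 - \<delta>) * r\<close> w by (force simp: l_def)
  ultimately show ?thesis using that[of v] v(1) by (auto simp: outer_nbrs_def nbrs_def l_def)
qed

lemma outer_nbrs_nonempty:
  fixes x :: "real^'n"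
  assumes V: "eps_dense \<epsilon> V" and w: "4 * \<epsilon> \<le> \<delta> * r" "\<delta> \<le> 1/2" "0 < \<epsilon>" "0 < r" "r \<le> 1/2"
    and x: "x \<in> cbox 0 1"
  shows "outer_nbrs V r \<delta> x \<noteq> {}"
proof -
  \<comment> \<open>The neighbour is found in the direction of a coordinate axis, pointing away from the nearer of
    the two facets.\<close>
  fix i :: 'n
  define s :: real where "s = (if x $ i \<le> 1/2 then 1 else -1)"
  define p where "p = x + (s * r) *\<^sub>R axis i 1"
  have s: "\<bar>s\<bar> = 1" by (simp add: s_def)
  have n: "norm (p - x) = r" using w s by (simp add: p_def abs_mult)
  have in_C: "x + (t / norm (p - x)) *\<^sub>R (p - x) \<in> cbox 0 1" if "0 \<le> t" "t \<le> r" for t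
  proof -
    have "x + (t / norm (p - x)) *\<^sub>R (p - x) = x + (s * t) *\<^sub>R axis i 1"
      unfolding n using w by (simp add: p_def)
    also have "\<dots> \<in> cbox 0 1"
    proof -
      have "0 \<le> x $ j + s * t * (if j = i then 1 else 0)
            \<and> x $ j + s * t * (if j = i then 1 else 0) \<le> 1" for j
      proof -
        have "0 \<le> x $ j" "x $ j \<le> 1" using x by (auto simp: mem_box_cart)
        then show ?thesis using that w by (cases "j = i") (simp_all add: s_def)
      qed
      then show ?thesis by (simp add: mem_box_cart axis_def)
    qed
    finally show ?thesis .
  qed
  have "(1 - \<delta>) * r \<le> norm (p - x)" using n w by (simp add: field_simps)
  then show ?thesis using outer_nbrs_near[OF V w(1-4) _ _ in_C] n by (metis empty_iff order_refl)
qed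

lemma outer_nbrs_near_interior:
  fixes x p :: "real^'n"
  assumes V: "eps_dense \<epsilon> V" and w: "4 * \<epsilon> \<le> \<delta> * r" "\<delta> \<le> 1/2" "0 < \<epsilon>" "0 < r"
    and x: "cball x r \<subseteq> cbox 0 1" and p: "(1 - \<delta>) * r \<le> norm (p - x)" "norm (p - x) \<le> r"
  obtains v where "v \<in> outer_nbrs V r \<delta> x" "norm (v - p) \<le> 3 * \<epsilon>"
proof (rule outer_nbrs_near[OF V w p])
  fix t assume "0 \<le> t" "t \<le> r"
  then have "x + (t / norm (p - x)) *\<^sub>R (p - x) \<in> cball x r" using w
    by (simp add: dist_norm)
  then show "x + (t / norm (p - x)) *\<^sub>R (p - x) \<in> cbox 0 1" using x by blast
qed

lemma reflection_in:
  fixes V :: "(real^'n::{finite,linorder}) set"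
  assumes "finite V" "y \<in> outer_nbrs V r \<delta> x"
  shows "reflection V r \<delta> x y \<in> outer_nbrs V r \<delta> x"
  unfolding reflection_def
  by (rule lex_argmin_in) (use assms in \<open>auto simp: outer_nbrs_def nbrs_def\<close>)

text \<open>The exact mirror image \<open>2x - y\<close> has the same distance from \<open>x\<close>
  as \<open>y\<close>, so some outer neighbour lies within \<open>3 * \<epsilon>\<close> of it, and
  the reflection is at least as good by minimality.\<close>

lemma reflection_near:
  fixes V :: "(real^'n::{finite,linorder}) set"
  assumes V: "eps_dense \<epsilon> V" and w: "4 * \<epsilon> \<le> \<delta> * r" "\<delta> \<le> 1/2" "0 < \<epsilon>" "0 < r"
    and x: "cball x r \<subseteq> cbox 0 1" and y: "y \<in> outer_nbrs V r \<delta> x"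
  shows "norm (reflection V r \<delta> x y + y - 2 *\<^sub>R x) \<le> 3 * \<epsilon>"
proof -
  have e: "norm (2 *\<^sub>R x - y - x) = norm (x - y)" by (simp add: algebra_simps scaleR_2)
  obtain v where v: "v \<in> outer_nbrs V r \<delta> x" "norm (v - (2 *\<^sub>R x - y)) \<le> 3 * \<epsilon>"
    by (rule outer_nbrs_near_interior[OF V w x, of "2 *\<^sub>R x - y"])
       (use y e in \<open>auto simp: outer_nbrs_def nbrs_def\<close>)
  have fin: "finite (outer_nbrs V r \<delta> x)"
    using V by (simp add: outer_nbrs_def nbrs_def eps_dense_def)
  have "(norm (reflection V r \<delta> x y + y - 2 *\<^sub>R x))\<^sup>2 \<le> (norm (v + y - 2 *\<^sub>R x))\<^sup>2"
    unfolding reflection_def by (rule lex_argmin_le[OF fin v(1)])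
  then have "norm (reflection V r \<delta> x y + y - 2 *\<^sub>R x) \<le> norm (v + y - 2 *\<^sub>R x)"
    by (rule power2_le_imp_le) simp
  also have "\<dots> \<le> 3 * \<epsilon>" using v(2) by (simp add: algebra_simps)
  finally show ?thesis .
qed

section \<open>Density of the random vertices\<close>

definition grid_cell :: "nat \<Rightarrow> ('n \<Rightarrow> nat) \<Rightarrow> (real^'n) set" where
  "grid_cell m k = cbox (\<chi> i. real (k i) / real m) (\<chi> i. (real (k i) + 1) / real m)"

definition grid_indices :: "nat \<Rightarrow> ('n::finite \<Rightarrow> nat) set" where
  "grid_indices m = PiE UNIV (\<lambda>_. {..<m})"

lemma finite_grid_indices: "finite (grid_indices m)"
  unfolding grid_indices_def by (rule finite_PiE) auto

lemma card_grid_indices: "card (grid_indices m :: ('n::finite \<Rightarrow> nat) set) = m ^ CARD('n)"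
  unfolding grid_indices_def by (subst card_PiE) auto

lemma grid_cell_subset:
  assumes "0 < m" "k \<in> grid_indices m"
  shows "grid_cell m k \<subseteq> cbox 0 1"
proof
  fix x assume x: "x \<in> grid_cell m k"
  have "0 \<le> x $ i \<and> x $ i \<le> 1" for i
  proof -
    have "Suc (k i) \<le> m" using assms(2) by (simp add: grid_indices_def PiE_iff Suc_le_eq)
    then have "real (k i) + 1 \<le> real m" using of_nat_mono[of "Suc (k i)" m] by simp
    then have "(real (k i) + 1) / real m \<le> 1" using assms(1) by simp
    moreover have "real (k i) / real m \<le> x $ i" "x $ i \<le> (real (k i) + 1) / real m"
      using x by (auto simp: grid_cell_def mem_box_cart)
    moreover have "0 \<le> real (k i) / real m" by simp
    ultimately show ?thesis by linarith
  qed
  then show "x \<in> cbox 0 1" by (simp add: mem_box_cart)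
qed

lemma grid_cell_cover:
  fixes x :: "real^'n"
  assumes m: "0 < m" and x: "x \<in> cbox 0 1"
  obtains k where "k \<in> grid_indices m" "x \<in> grid_cell m k"
proof -
  \<comment> \<open>On the upper facets the floor would give the index \<open>m\<close>, one too
    large; these points go to the last cell.\<close>
  define k where "k i = (if x $ i = 1 then m - 1 else nat \<lfloor>x $ i * real m\<rfloor>)" for i
  have xi: "0 \<le> x $ i" "x $ i \<le> 1" for i using x by (auto simp: mem_box_cart)
  have k: "k i < m \<and> real (k i) \<le> x $ i * real m \<and> x $ i * real m \<le> real (k i) + 1" for i
  proof (cases "x $ i = 1")
    case True
    then show ?thesis using m by (simp add: k_def)
  next
    case False
    then have "x $ i * real m < 1 * real m" using m xi[of i] by (intro mult_strict_right_mono) auto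
    moreover have "0 \<le> x $ i * real m" using xi[of i] by simp
    ultimately show ?thesis using False unfolding k_def by (simp add: nat_less_iff floor_less_iff)
  qed
  have "k \<in> grid_indices m" using k by (auto simp: grid_indices_def)
  moreover have "x \<in> grid_cell m k"
    using k m by (simp add: grid_cell_def mem_box_cart pos_divide_le_eq pos_le_divide_eq)
  ultimately show ?thesis by (rule that)
qed

lemma grid_cell_diameter:
  fixes x y :: "real^'n"
  assumes "0 < m" "x \<in> grid_cell m k" "y \<in> grid_cell m k"
  shows "norm (x - y) \<le> real CARD('n) / real m"
proof -
  have "norm (x - y) \<le> (\<Sum>i\<in>UNIV. \<bar>(x - y) $ i\<bar>)" by (rule norm_le_l1_cart)
  also have "\<dots> \<le> (\<Sum>i\<in>(UNIV :: 'n set). 1 / real m)"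
  proof (rule sum_mono)
    fix i
    have "real (k i) / real m \<le> x $ i" "x $ i \<le> real (k i) / real m + 1 / real m"
      "real (k i) / real m \<le> y $ i" "y $ i \<le> real (k i) / real m + 1 / real m"
      using assms by (auto simp: grid_cell_def mem_box_cart add_divide_distrib)
    then show "\<bar>(x - y) $ i\<bar> \<le> 1 / real m" by (simp add: abs_le_iff)
  qed
  finally show ?thesis by simp
qed

section \<open>Probability of an empty grid cell\<close>

abbreviation unif_cube :: "(real^'n) measure" where
  "unif_cube \<equiv> uniform_measure lborel (cbox 0 1)"

lemma emeasure_cube: "emeasure lborel (cbox 0 1 :: (real^'n) set) = 1"
proof -
  have "emeasure lborel (cbox 0 1 :: (real^'n) set) = ennreal (measure lborel (cbox 0 1 :: (real^'n) set))"
    by (rule emeasure_eq_ennreal_measure) (use emeasure_lborel_cbox_finite in \<open>auto simp: less_top\<close>)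
  then show ?thesis by (simp add: content_cbox_cart interval_ne_empty_cart)
qed

lemma prob_space_unif_cube: "prob_space (unif_cube :: (real^'n) measure)"
  by (rule prob_space_uniform_measure) (simp_all add: emeasure_cube)

lemma measure_grid_cell:
  assumes "0 < m" "k \<in> grid_indices m"
  shows "measure (unif_cube :: (real^'n) measure) (grid_cell m k) = 1 / real m ^ CARD('n)"
proof -
  have ne: "grid_cell m k \<noteq> {}"
    unfolding grid_cell_def using assms(1) by (simp add: interval_ne_empty_cart divide_right_mono)
  have "measure (unif_cube :: (real^'n) measure) (grid_cell m k) = measure lborel (grid_cell m k)"
  proof -
    have "measure lborel (cbox 0 1 :: (real^'n) set) = 1" using emeasure_cube by (simp add: measure_def)
    then show ?thesis
      using grid_cell_subset[OF assms]
      by (subst measure_uniform_measure) (simp_all add: emeasure_cube grid_cell_def Int_absorb1)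
  qed
  also have "\<dots> = 1 / real m ^ CARD('n)"
    using ne unfolding grid_cell_def
    by (simp add: content_cbox_cart add_divide_distrib power_one_over)
  finally show ?thesis .
qed

definition empty_cell_event :: "nat \<Rightarrow> nat \<Rightarrow> (nat \<Rightarrow> real^'n) set" where
  "empty_cell_event m n =
     (\<Union>k\<in>grid_indices m. {X \<in> space sample_space. \<forall>i\<in>{1..n}. X i \<in> - grid_cell m k})"

lemma sample_space_cylinder:
  fixes A :: "(real^'n) set"
  assumes "A \<in> sets borel"
  shows "{X \<in> space sample_space. \<forall>i\<in>{1..n}. X i \<in> A} \<in> sets sample_space"
    "measure sample_space {X \<in> space sample_space. \<forall>i\<in>{1..n}. X i \<in> A} = measure unif_cube A ^ n"
proof -
  interpret product_prob_space "\<lambda>_::nat. unif_cube :: (real^'n) measure" UNIV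
    by (rule product_prob_spaceI) (rule prob_space_unif_cube)
  have eq: "{X \<in> space sample_space. \<forall>i\<in>{1..n}. X i \<in> A} =
      prod_emb UNIV (\<lambda>_. unif_cube) {1..n} (Pi\<^sub>E {1..n} (\<lambda>_. A))"
    by (auto simp: sample_space_def prod_emb_def space_PiM PiE_iff)
  show "{X \<in> space sample_space. \<forall>i\<in>{1..n}. X i \<in> A} \<in> sets sample_space"
    unfolding eq unfolding sample_space_def using assms by (intro sets_PiM_I) auto
  show "measure sample_space {X \<in> space sample_space. \<forall>i\<in>{1..n}. X i \<in> A} = measure unif_cube A ^ n"
    unfolding eq unfolding sample_space_def by (subst measure_PiM_emb) (use assms in auto)
qed

lemma prob_space_sample_space: "prob_space (sample_space :: (nat \<Rightarrow> real^'n) measure)"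
  unfolding sample_space_def by (intro prob_space_PiM prob_space_unif_cube)

lemma sets_empty_cell_event: "empty_cell_event m n \<in> sets sample_space"
  unfolding empty_cell_event_def
  by (intro sets.finite_UN finite_grid_indices sample_space_cylinder(1)) (simp add: grid_cell_def)

text \<open>Union bound over the cells: each one is missed by \<open>n\<close> independent points
  with probability \<open>(1 - 1 / M) ^ n\<close>, where \<open>M\<close> is the number of cells,
  and \<open>1 - t \<le> exp (- t)\<close>.\<close>

lemma measure_empty_cell_event:
  assumes m: "0 < m"
  shows "measure sample_space (empty_cell_event m n :: (nat \<Rightarrow> real^'n) set)
    \<le> real m ^ CARD('n) * exp (- (real n / real m ^ CARD('n)))"
proof -
  interpret prob_space "sample_space :: (nat \<Rightarrow> real^'n) measure" by (rule prob_space_sample_space)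
  interpret U: prob_space "unif_cube :: (real^'n) measure" by (rule prob_space_unif_cube)
  let ?M = "real m ^ CARD('n)"
  have M: "1 \<le> ?M" using m by simp
  have cell: "- grid_cell m k \<in> sets (borel :: (real^'n) measure)" for k
    by (simp add: grid_cell_def)
  have "prob (empty_cell_event m n :: (nat \<Rightarrow> real^'n) set)
      \<le> (\<Sum>k\<in>(grid_indices m :: ('n \<Rightarrow> nat) set).
          prob {X \<in> space sample_space. \<forall>i\<in>{1..n}. X i \<in> - grid_cell m k})"
    unfolding empty_cell_event_def
    by (rule finite_measure_subadditive_finite[OF finite_grid_indices])
       (blast intro: sample_space_cylinder(1) cell)
  also have "\<dots> = (\<Sum>k\<in>(grid_indices m :: ('n \<Rightarrow> nat) set). (1 - 1 / ?M) ^ n)"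
  proof (rule sum.cong)
    fix k :: "'n \<Rightarrow> nat" assume k: "k \<in> grid_indices m"
    have "measure unif_cube (- grid_cell m k) = 1 - measure unif_cube (grid_cell m k)"
      using U.prob_compl[of "grid_cell m k"] by (simp add: grid_cell_def Compl_eq_Diff_UNIV)
    then show "prob {X \<in> space sample_space. \<forall>i\<in>{1..n}. X i \<in> - grid_cell m k} = (1 - 1 / ?M) ^ n"
      using sample_space_cylinder(2)[of "- grid_cell m k" n] measure_grid_cell[OF m k]
      by (simp add: grid_cell_def)
  qed simp
  also have "\<dots> = ?M * (1 - 1 / ?M) ^ n" by (simp add: card_grid_indices)
  also have "(1 - 1 / ?M) ^ n \<le> exp (- (1 / ?M)) ^ n"
    using exp_ge_add_one_self[of "- (1 / ?M)"] M by (intro power_mono) (auto simp: divide_le_eq_1)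
  also have "exp (- (1 / ?M)) ^ n = exp (- (real n / ?M))"
    by (simp flip: exp_of_nat_mult)
  finally show ?thesis using M by (simp add: mult_left_mono)
qed

lemma AE_sample_cube: "AE X in (sample_space :: (nat \<Rightarrow> real^'n) measure). \<forall>i. X i \<in> cbox 0 1"
  unfolding AE_all_countable
proof
  fix i
  have "AE x in (unif_cube :: (real^'n) measure). x \<in> cbox 0 1"
    by (rule AE_uniform_measureI) auto
  then show "AE X in (sample_space :: (nat \<Rightarrow> real^'n) measure). X i \<in> cbox 0 1"
    unfolding sample_space_def by (intro AE_PiM_component prob_space_unif_cube) auto
qed

lemma eps_dense_vertices:
  fixes X :: "nat \<Rightarrow> real^'n"
  assumes m: "0 < m" "real CARD('n) / real m \<le> \<epsilon>" and X: "\<And>i. X i \<in> cbox 0 1"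
    and ne: "X \<in> space sample_space - empty_cell_event m n"
  shows "eps_dense \<epsilon> (vertices X n)"
  unfolding eps_dense_def
proof (intro conjI ballI)
  fix p :: "real^'n" assume "p \<in> cbox 0 1"
  then obtain k where k: "k \<in> grid_indices m" "p \<in> grid_cell m k" using grid_cell_cover[OF m(1)] by blast
  then obtain i where "i \<in> {1..n}" "X i \<in> grid_cell m k"
    using ne by (auto simp: empty_cell_event_def)
  then show "\<exists>v\<in>vertices X n. norm (v - p) \<le> \<epsilon>"
    using grid_cell_diameter[OF m(1) _ k(2)] m(2) by (force simp: vertices_def)
qed (use X in \<open>auto simp: vertices_def\<close>)

lemma filterlim_ln_nat: "filterlim (\<lambda>n. ln (real n)) at_top sequentially"
  by (rule filterlim_compose[OF ln_at_top filterlim_real_sequentially])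

text \<open>Will turn a cell count \<open>M \<le> 2 ^ d * l ^ d * sqrt n\<close> with
  \<open>l = ln n\<close> into \<open>3 * l * M \<le> n\<close>. With \<open>x = ln n / 2\<close>
  one has \<open>exp x = sqrt n\<close>, so this is the domination of a power by the exponential;
  \<open>C\<close> collects the powers of 2 that come from halving the logarithm.\<close>

lemma eventually_polylog_le_sqrt:
  "\<forall>\<^sub>F n in sequentially. 3 * 2 ^ d * ln (real n) ^ Suc d \<le> sqrt (real n)"
proof -
  define C :: real where "C = 3 * 2 ^ d * 2 ^ Suc d"
  have "C > 0" by (simp add: C_def)
  have "((\<lambda>x::real. x ^ Suc d / exp x) \<longlongrightarrow> 0) at_top" by (rule tendsto_power_div_exp_0)
  then have "\<forall>\<^sub>F x in at_top. x ^ Suc d / exp x < 1 / C"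
    using \<open>C > 0\<close> by (intro order_tendstoD(2)) auto
  moreover have "filterlim (\<lambda>n. ln (real n) / 2) at_top sequentially"
    using filterlim_tendsto_pos_mult_at_top[OF tendsto_const[of "1 / 2"] _ filterlim_ln_nat] by simp
  ultimately have "\<forall>\<^sub>F n in sequentially. (ln (real n) / 2) ^ Suc d / exp (ln (real n) / 2) < 1 / C"
    by (rule eventually_compose_filterlim)
  moreover have "\<forall>\<^sub>F n :: nat in sequentially. n > 0" by (rule eventually_gt_at_top)
  ultimately show ?thesis
  proof eventually_elim
    case (elim n)
    have "exp (ln (real n) / 2) = sqrt (real n)" using elim by (simp flip: ln_sqrt)
    then have "(ln (real n) / 2) ^ Suc d / sqrt (real n) < 1 / C" using elim(1) by simp
    then have "(ln (real n) / 2) ^ Suc d * C < sqrt (real n)"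
      using elim \<open>C > 0\<close> by (simp add: divide_less_eq pos_less_divide_eq mult.commute del: power_Suc)
    moreover have "(ln (real n) / 2) ^ Suc d * C = 3 * 2 ^ d * ln (real n) ^ Suc d"
      by (simp add: C_def power_divide del: power_Suc)
    ultimately show ?case by linarith
  qed
qed

text \<open>The grid width \<open>r\<^sub>n\<^sup>2 / log n\<close> is negligible against the width \<open>\<delta>\<^sub>n r\<^sub>n\<close> of the annuli, while the
  number of cells is at most \<open>n / (3 log n)\<close>, so that the probability of an empty cell is summable.\<close>

lemma AE_eventually_eps_dense:
  fixes r :: "nat \<Rightarrow> real"
  assumes pos: "\<And>n. r n > 0" and r0: "r \<longlonglongrightarrow> 0"
    and lim: "filterlim (\<lambda>n. sqrt (real n) * r n ^ (2 * CARD('n)) / ln (real n)) at_top sequentially"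
  shows "AE X in (sample_space :: (nat \<Rightarrow> real^'n) measure).
    \<forall>\<^sub>F n in sequentially. eps_dense (real CARD('n) * (r n)\<^sup>2 / ln (real n)) (vertices X n)"
proof -
  define d where "d = CARD('n)"
  define m where "m n = Suc (nat \<lceil>ln (real n) / (r n)\<^sup>2\<rceil>)" for n
  let ?A = "\<lambda>n. empty_cell_event (m n) n :: (nat \<Rightarrow> real^'n) set"
  have ln_large: "\<forall>\<^sub>F n in sequentially. 2 \<le> ln (real n)"
    using filterlim_ln_nat unfolding filterlim_at_top by blast
  have r_small: "\<forall>\<^sub>F n in sequentially. r n < 1" using r0 by (intro order_tendstoD(2)) auto
  have ratio: "\<forall>\<^sub>F n in sequentially. 1 \<le> sqrt (real n) * r n ^ (2 * d) / ln (real n)"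
    using lim unfolding filterlim_at_top d_def by blast
  have small: "\<forall>\<^sub>F n in sequentially. measure sample_space (?A n) \<le> 1 / real n ^ 2"
    using ln_large r_small ratio eventually_polylog_le_sqrt[of d] eventually_gt_at_top[of 1]
  proof eventually_elim
    case (elim n)
    define l where "l = ln (real n)"
    define M where "M = real (m n) ^ d"
    have l: "2 \<le> l" using elim by (simp add: l_def)
    have rn: "0 < r n" "r n < 1" using pos elim by auto
    have r2: "0 < (r n)\<^sup>2" "(r n)\<^sup>2 < 1" using rn by (auto simp: power_less_one_iff)
    \<comment> \<open>Rounding up costs at most 2, which this bound absorbs into a factor 2.\<close>
    have "2 \<le> l / (r n)\<^sup>2" using l r2 by (simp add: pos_le_divide_eq)
    moreover have "real (m n) \<le> l / (r n)\<^sup>2 + 2"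
      using l r2 unfolding m_def l_def[symmetric] by (simp add: of_nat_nat) linarith
    ultimately have "real (m n) \<le> 2 * l / (r n)\<^sup>2" by linarith
    then have "M \<le> (2 * l / (r n)\<^sup>2) ^ d" unfolding M_def by (intro power_mono) auto
    also have "\<dots> = 2 ^ d * l ^ d / r n ^ (2 * d)"
      by (simp add: power_divide power_mult_distrib power_mult)
    also have "\<dots> \<le> 2 ^ d * l ^ d * (sqrt (real n) / l)"
    proof -
      have "1 / r n ^ (2 * d) \<le> sqrt (real n) / l"
        using elim(3) l rn by (simp add: l_def[symmetric] field_simps)
      then have "(2 ^ d * l ^ d) * (1 / r n ^ (2 * d)) \<le> 2 ^ d * l ^ d * (sqrt (real n) / l)"
        using l by (intro mult_left_mono) auto
      then show ?thesis by simp
    qed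
    also have "\<dots> \<le> 2 ^ d * l ^ d * sqrt (real n)"
      using l by (intro mult_left_mono) (auto simp: divide_le_eq mult_le_cancel_left1)
    finally have M1: "M \<le> 2 ^ d * l ^ d * sqrt (real n)" .
    have "3 * l * M \<le> 3 * l * (2 ^ d * l ^ d * sqrt (real n))"
      using M1 l by (intro mult_left_mono) auto
    also have "\<dots> = (3 * 2 ^ d * l ^ Suc d) * sqrt (real n)" by simp
    also have "\<dots> \<le> sqrt (real n) * sqrt (real n)"
      using elim(4) by (intro mult_right_mono) (auto simp: l_def)
    finally have M2: "3 * l * M \<le> real n" by simp
    have Mpos: "0 < M" by (simp add: M_def m_def)
    have "1 * M \<le> 3 * l * M" using l Mpos by (intro mult_right_mono) auto
    then have M3: "M \<le> real n" using M2 by simp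
    \<comment> \<open>The 3 in \<open>3 * l * M \<le> n\<close> makes the exponential at most
      \<open>n\<close> to the power -3; after the union bound over at most \<open>n\<close> cells a
      summable inverse square remains.\<close>
    have "measure sample_space (?A n) \<le> M * exp (- (real n / M))"
      unfolding M_def d_def by (rule measure_empty_cell_event) (simp add: m_def)
    also have "\<dots> \<le> real n * exp (- (3 * l))"
      using M2 M3 Mpos by (intro mult_mono) (auto simp: pos_le_divide_eq)
    also have "exp (- (3 * l)) = 1 / real n ^ 3"
    proof -
      have "exp (3 * l) = exp l ^ 3" by (simp flip: exp_of_nat_mult)
      then show ?thesis using elim(5) by (simp add: exp_minus l_def inverse_eq_divide)
    qed
    also have "real n * (1 / real n ^ 3) = 1 / real n ^ 2"
      using elim(5) by (simp add: power3_eq_cube power2_eq_square)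
    finally show ?case .
  qed
  have "summable (\<lambda>n. 1 / real n ^ 2)" using inverse_power_summable[of 2] by (simp add: inverse_eq_divide)
  then have "summable (\<lambda>n. measure sample_space (?A n))"
    by (rule summable_comparison_test_ev[rotated]) (use small in simp)
  moreover have "emeasure sample_space (?A n) < \<infinity>" for n
    using finite_measure.emeasure_finite[OF prob_space.finite_measure[OF prob_space_sample_space], of "?A n"]
    by (simp add: less_top)
  ultimately have "AE X in sample_space. \<forall>\<^sub>F n in sequentially. X \<in> space sample_space - ?A n"
    by (intro borel_cantelli_AE1 sets_empty_cell_event) auto
  with AE_sample_cube show ?thesis
  proof eventually_elim
    case (elim X)
    from elim(2) ln_large show ?case
    proof eventually_elim
      case (elim n)
      have r2: "0 < (r n)\<^sup>2" using pos[of n] by simp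
      have "ln (real n) / (r n)\<^sup>2 \<le> real (m n)" unfolding m_def by linarith
      moreover have "0 < ln (real n) / (r n)\<^sup>2" using elim r2 by simp
      ultimately have "real CARD('n) / real (m n) \<le> real CARD('n) / (ln (real n) / (r n)\<^sup>2)"
        by (intro divide_left_mono mult_pos_pos) auto
      then have "real CARD('n) / real (m n) \<le> real CARD('n) * (r n)\<^sup>2 / ln (real n)" by simp
      then show ?case using \<open>\<forall>i. X i \<in> cbox 0 1\<close> elim(1)
        by (intro eps_dense_vertices[of "m n"]) (auto simp: m_def)
    qed
  qed
qed

section \<open>Supermartingales along the game\<close>

text \<open>The path at time \<open>min k \<tau>\<close>, where \<open>\<tau>\<close> is the first
  visit to \<open>B\<close>. The recursion avoids mentioning \<open>\<tau>\<close>, which may be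
  infinite.\<close>

primrec stopped :: "'a set \<Rightarrow> (nat \<Rightarrow> 'a) \<Rightarrow> nat \<Rightarrow> 'a" where
  "stopped B x 0 = x 0"
| "stopped B x (Suc k) = (if \<forall>j\<le>k. x j \<notin> B then x (Suc k) else stopped B x k)"

lemma stopped_cong:
  "(\<And>j. j \<le> k \<Longrightarrow> x j = y j) \<Longrightarrow> stopped B x k = stopped B y k"
  by (induction k) auto

lemma stopped_alive: "\<forall>j\<le>k. x j \<notin> B \<Longrightarrow> stopped B x k = x k"
  by (induction k) auto

lemma stopped_hit:
  "\<not> (\<forall>j\<le>k. x j \<notin> B) \<Longrightarrow> \<exists>j. x j \<in> B \<and> (\<forall>i<j. x i \<notin> B) \<and> stopped B x k = x j"
proof (induction k)
  case (Suc k)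
  show ?case
  proof (cases "\<forall>j\<le>k. x j \<notin> B")
    case True
    then have "x (Suc k) \<in> B" using Suc.prems le_Suc_eq by auto
    then show ?thesis using True by (intro exI[of _ "Suc k"]) auto
  next
    case False
    then show ?thesis using Suc.IH by auto
  qed
qed auto

lemma payoff_stopped:
  assumes "\<not> (\<forall>j\<le>k. x j \<notin> B)"
  shows "payoff B f x = f (stopped B x k)" "stopped B x k \<in> B"
proof -
  obtain j where j: "x j \<in> B" "\<forall>i<j. x i \<notin> B" "stopped B x k = x j"
    using stopped_hit[OF assms] by blast
  have "(LEAST k. x k \<in> B) = j"
    by (rule Least_equality) (use j in \<open>auto simp: not_less[symmetric]\<close>)
  then show "payoff B f x = f (stopped B x k)" using j by (auto simp: payoff_def)
  show "stopped B x k \<in> B" using j by simp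
qed

lemma payoff_uminus: "payoff B (\<lambda>x. - f x) = (\<lambda>y. - payoff B f y)"
  by (rule ext) (simp add: payoff_def)

lemma payoff_bound:
  assumes "finite B"
  shows "\<bar>payoff B f x\<bar> \<le> (\<Sum>b\<in>B. \<bar>f b\<bar>)"
proof (cases "\<exists>k. x k \<in> B")
  case True
  then have "x (LEAST k. x k \<in> B) \<in> B" by (rule LeastI_ex)
  then show ?thesis using True member_le_sum[of _ B "\<lambda>b. \<bar>f b\<bar>"] assms by (simp add: payoff_def)
qed (simp add: payoff_def sum_nonneg)

text \<open>No measurability of \<open>f\<close> is available. Since only its values on the finite
  set \<open>B\<close> enter, it can be replaced by \<open>f'\<close>, a finite combination of
  indicators of points.\<close>

lemma measurable_payoff:
  assumes "finite B"
  shows "payoff B f \<in> borel_measurable (PiM UNIV (\<lambda>_. borel))"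
proof -
  define f' where "f' x = (\<Sum>b\<in>B. f b * indicator {b} x)" for x
  have f': "f' x = f x" if "x \<in> B" for x
  proof -
    have "f' x = (\<Sum>b\<in>B. if b = x then f x else 0)"
      unfolding f'_def by (rule sum.cong) auto
    then show ?thesis using that assms by simp
  qed
  have [measurable]: "f' \<in> borel_measurable borel" unfolding f'_def by measurable
  have [measurable]: "B \<in> sets borel" using assms by (simp add: finite_imp_closed)
  have eq: "payoff B f x = (if \<exists>k. x k \<in> B then f' (x (LEAST k. x k \<in> B)) else 0)" for x
  proof (cases "\<exists>k. x k \<in> B")
    case True
    then have "x (LEAST k. x k \<in> B) \<in> B" by (rule LeastI_ex)
    then show ?thesis using True by (simp add: payoff_def f')
  qed (simp add: payoff_def)
  have [measurable]: "Measurable.pred (PiM UNIV (\<lambda>_. borel)) (\<lambda>x. x k \<in> B)" for k :: nat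
    by measurable
  have "(\<lambda>x. (LEAST k::nat. x k \<in> B)) \<in> measurable (PiM UNIV (\<lambda>_. borel)) (count_space UNIV)"
    by (rule measurable_Least) measurable
  then have [measurable]: "(\<lambda>x. f' (x (LEAST k::nat. x k \<in> B))) \<in> borel_measurable (PiM UNIV (\<lambda>_. borel))"
    by (rule measurable_compose_countable[where f="\<lambda>(k::nat) x. f' (x k)", rotated]) measurable
  have "(\<lambda>x. if \<exists>k::nat. x k \<in> B then f' (x (LEAST k. x k \<in> B)) else 0)
      \<in> borel_measurable (PiM UNIV (\<lambda>_. borel))"
    by measurable
  then show ?thesis using eq by (subst measurable_cong) auto
qed

section \<open>Sequences of fair coins and the flip of one toss\<close>

abbreviation coins :: "(nat \<Rightarrow> bool) measure" where
  "coins \<equiv> PiM UNIV (\<lambda>_. measure_pmf (bernoulli_pmf (1/2)))"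

lemma prob_space_coins: "prob_space coins"
  by (intro prob_space_PiM prob_space_measure_pmf)

lemma map_pmf_Not_bernoulli: "map_pmf Not (bernoulli_pmf (1/2)) = bernoulli_pmf (1/2)"
proof (rule pmf_eqI)
  fix b
  have "pmf (map_pmf Not (bernoulli_pmf (1/2))) (Not (\<not> b)) = pmf (bernoulli_pmf (1/2)) (\<not> b)"
    by (rule pmf_map_inj') (auto simp: inj_def)
  then show "pmf (map_pmf Not (bernoulli_pmf (1/2))) b = pmf (bernoulli_pmf (1/2)) b"
    by (cases b) auto
qed

lemma measurable_flip: "(\<lambda>c. c(k := \<not> c k)) \<in> measurable coins coins"
  by (rule measurable_PiM_single') (auto simp: space_PiM fun_upd_def)

text \<open>It suffices to compare cylinder sets: the preimage under the flip is the cylinder with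
  the \<open>k\<close>-th factor negated, and a fair coin is invariant under negation.\<close>

lemma distr_coins_flip: "distr coins coins (\<lambda>c. c(k := \<not> c k)) = coins"
proof (rule measure_eqI_PiM_infinite)
  let ?M = "\<lambda>_::nat. measure_pmf (bernoulli_pmf (1/2))"
  fix A :: "nat \<Rightarrow> bool set" and J :: "nat set"
  assume J: "finite J"
  define A' where "A' = A(k := Not -` A k)"
  have "emeasure (distr coins coins (\<lambda>c. c(k := \<not> c k))) (prod_emb UNIV ?M J (Pi\<^sub>E J A)) =
      emeasure coins ((\<lambda>c. c(k := \<not> c k)) -` prod_emb UNIV ?M J (Pi\<^sub>E J A) \<inter> space coins)"
    by (rule emeasure_distr[OF measurable_flip]) (auto intro!: sets_PiM_I J)
  also have "(\<lambda>c. c(k := \<not> c k)) -` prod_emb UNIV ?M J (Pi\<^sub>E J A) \<inter> space coins =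
      prod_emb UNIV ?M J (Pi\<^sub>E J A')"
    by (auto simp: prod_emb_def space_PiM A'_def PiE_iff split: if_splits)
  also have "emeasure coins \<dots> = (\<Prod>i\<in>J. emeasure (?M i) (A' i))"
    by (rule emeasure_PiM_emb) (auto simp: J prob_space_measure_pmf)
  also have "\<dots> = (\<Prod>i\<in>J. emeasure (?M i) (A i))"
  proof (rule prod.cong)
    fix i
    show "emeasure (?M i) (A' i) = emeasure (?M i) (A i)"
      by (cases "i = k")
         (simp_all add: A'_def emeasure_map_pmf[symmetric] map_pmf_Not_bernoulli del: emeasure_map_pmf)
  qed simp
  also have "\<dots> = emeasure coins (prod_emb UNIV ?M J (Pi\<^sub>E J A))"
    by (rule emeasure_PiM_emb[symmetric]) (auto simp: J prob_space_measure_pmf)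
  finally show "emeasure (distr coins coins (\<lambda>c. c(k := \<not> c k))) (prod_emb UNIV ?M J (Pi\<^sub>E J A)) =
      emeasure coins (prod_emb UNIV ?M J (Pi\<^sub>E J A))" .
next
  show "finite_measure (distr coins coins (\<lambda>c. c(k := \<not> c k)))"
    using prob_space.prob_space_distr[OF prob_space_coins measurable_flip]
    by (rule prob_space.finite_measure)
qed simp_all

text \<open>Replaces conditioning on the past of round \<open>k\<close>: averaging over a sequence
  and its flip at \<open>k\<close> averages over the two outcomes of that round while the other
  tosses are kept.\<close>

lemma integral_coins_nonpos:
  fixes F :: "(nat \<Rightarrow> bool) \<Rightarrow> real"
  assumes "integrable coins F" "\<And>c. F c + F (c(k := \<not> c k)) \<le> 0"
  shows "integral\<^sup>L coins F \<le> 0"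
proof -
  have F: "F \<in> borel_measurable coins" using assms(1) by simp
  have i: "integrable coins (\<lambda>c. F (c(k := \<not> c k)))"
    using integrable_distr[OF measurable_flip, of k F] assms(1) by (simp add: distr_coins_flip)
  have "integral\<^sup>L coins (\<lambda>c. F (c(k := \<not> c k))) = integral\<^sup>L coins F"
    using integral_distr[OF measurable_flip F, of k] by (simp add: distr_coins_flip)
  then have "2 * integral\<^sup>L coins F = integral\<^sup>L coins (\<lambda>c. F c + F (c(k := \<not> c k)))"
    using assms(1) i by simp
  also have "\<dots> \<le> 0"
    using integral_mono[of coins "\<lambda>c. F c + F (c(k := \<not> c k))" "\<lambda>_. 0"] assms i by simp
  finally show ?thesis by simp
qed

section \<open>Histories and positions as functions of the coins\<close>

lemma length_history [simp]: "length (history V r \<delta> S x0 c k) = Suc k"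
  by (induction k) (simp_all add: Let_def)

lemma history_nonempty [simp]: "history V r \<delta> S x0 c k \<noteq> []"
  using length_history[of V r \<delta> S x0 c k] by (metis Zero_not_Suc list.size(3))

lemma history_nth:
  "j \<le> k \<Longrightarrow> history V r \<delta> S x0 c k ! j = last (history V r \<delta> S x0 c j)"
proof (induction k)
  case (Suc k)
  show ?case
  proof (cases "j = Suc k")
    case True
    then show ?thesis by (simp add: Let_def nth_append)
  next
    case False
    then show ?thesis using Suc by (simp add: Let_def nth_append)
  qed
qed simp

lemma history_cong:
  "(\<And>j. j < k \<Longrightarrow> c j = c' j) \<Longrightarrow> history V r \<delta> S x0 c k = history V r \<delta> S x0 c' k"
  by (induction k) (auto simp: Let_def)

text \<open>With the discrete sigma-algebra as target, every function of the history is measurable,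
  in particular the moves of an arbitrary strategy.\<close>

lemma measurable_history:
  "(\<lambda>c. history V r \<delta> S x0 c k) \<in> measurable coins (count_space UNIV)"
proof (induction k)
  case (Suc k)
  have [measurable]: "Measurable.pred coins (\<lambda>c. c k)"
    using measurable_component_singleton[of k UNIV "\<lambda>_. measure_pmf (bernoulli_pmf (1/2))"]
    by (simp cong: measurable_cong_sets)
  have m: "(\<lambda>c. F (history V r \<delta> S x0 c k)) \<in> measurable coins (count_space UNIV)"
    for F :: "_ \<Rightarrow> (real^'a::{finite,linorder}) list"
    by (rule measurable_compose[OF Suc.IH]) simp
  have "(\<lambda>c. if c k then (history V r \<delta> S x0 c k) @ [S (history V r \<delta> S x0 c k)]
      else (history V r \<delta> S x0 c k) @
        [reflection V r \<delta> (last (history V r \<delta> S x0 c k)) (S (history V r \<delta> S x0 c k))])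
      \<in> measurable coins (count_space UNIV)"
    by (rule measurable_If[OF m m]) measurable
  then show ?case
    by (rule measurable_cong[THEN iffD1, rotated]) (simp add: Let_def)
qed simp

lemma measurable_history':
  fixes F :: "(real^'n::{finite,linorder}) list \<Rightarrow> 'b::topological_space"
  shows
  "(\<lambda>c. F (history V r \<delta> S x0 c k)) \<in> borel_measurable coins"
  by (rule measurable_compose[OF measurable_history]) simp

definition position ::
  "(real^'n::{finite,linorder}) set \<Rightarrow> real \<Rightarrow> real \<Rightarrow> ((real^'n::_) list \<Rightarrow> real^'n::_) \<Rightarrow> real^'n::_ \<Rightarrow>
     (nat \<Rightarrow> bool) \<Rightarrow> nat \<Rightarrow> real^'n::_" where
  "position V r \<delta> S x0 c k = last (history V r \<delta> S x0 c k)"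

lemma measurable_position:
  "position V r \<delta> S x0 \<in> measurable coins (PiM UNIV (\<lambda>_. borel))"
  by (rule measurable_PiM_single') (auto simp: position_def measurable_history')

lemma integral_payoff:
  assumes "finite B"
  shows "integral\<^sup>L (game_law V r \<delta> S x0) (payoff B f) =
    integral\<^sup>L coins (\<lambda>c. payoff B f (position V r \<delta> S x0 c))"
proof -
  have "game_law V r \<delta> S x0 = distr coins (PiM UNIV (\<lambda>_. borel)) (position V r \<delta> S x0)"
    unfolding game_law_def by (rule distr_cong) (auto simp: position_def)
  then show ?thesis
    using integral_distr[OF measurable_position measurable_payoff[OF assms]] by simp
qed

lemma integrable_coins_bounded:
  fixes F :: "(nat \<Rightarrow> bool) \<Rightarrow> real"
  assumes "F \<in> borel_measurable coins" "\<And>c. \<bar>F c\<bar> \<le> M"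
  shows "integrable coins F"
  using prob_space_coins assms
  by (intro finite_measure.integrable_const_bound[where B=M]) (auto intro: prob_space.finite_measure)

context
  fixes V :: "(real^'n::{finite,linorder}) set" and r \<delta> :: real
    and S :: "(real^'n::_) list \<Rightarrow> real^'n::_" and x0 :: "real^'n::_"
    and B :: "(real^'n::_) set"
begin

definition alive :: "nat \<Rightarrow> (nat \<Rightarrow> bool) \<Rightarrow> bool" where
  "alive k c \<longleftrightarrow> (\<forall>j\<le>k. position V r \<delta> S x0 c j \<notin> B)"

lemma alive_history: "alive k c \<longleftrightarrow> (\<forall>j\<le>k. history V r \<delta> S x0 c k ! j \<notin> B)"
  by (auto simp: alive_def position_def history_nth)

lemma stopped_history:
  "stopped B (position V r \<delta> S x0 c) k = stopped B (\<lambda>j. history V r \<delta> S x0 c k ! j) k"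
  by (rule stopped_cong) (simp add: position_def history_nth)

lemma measurable_stopped:
  fixes g :: "real^'n::_ \<Rightarrow> real"
  shows "(\<lambda>c. g (stopped B (position V r \<delta> S x0 c) k)) \<in> borel_measurable coins"
  unfolding stopped_history by (rule measurable_history')

lemma measurable_alive: "(\<lambda>c. of_bool (alive k c) :: real) \<in> borel_measurable coins"
  unfolding alive_history by (rule measurable_history')

text \<open>Sequences that differ only in toss \<open>k\<close> share the history up to time
  \<open>k\<close> and then move to the two possible next positions. So \<open>step\<close> bounds
  the sum of their increments by \<open>- 2 * a\<close> while the game is running; afterwards the
  stopped path is constant and both increments vanish.\<close>

lemma supermartingale_step:
  fixes g :: "real^'n::_ \<Rightarrow> real"
  assumes bd: "\<And>x. \<bar>g x\<bar> \<le> M"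
    and step: "\<And>c. alive k c \<Longrightarrow> g (S (history V r \<delta> S x0 c k)) +
      g (reflection V r \<delta> (position V r \<delta> S x0 c k) (S (history V r \<delta> S x0 c k)))
      \<le> 2 * (g (position V r \<delta> S x0 c k) - a)"
  shows "integral\<^sup>L coins (\<lambda>c. g (stopped B (position V r \<delta> S x0 c) (Suc k)))
    \<le> integral\<^sup>L coins (\<lambda>c. g (stopped B (position V r \<delta> S x0 c) k))
      - a * integral\<^sup>L coins (\<lambda>c. of_bool (alive k c))"
proof -
  let ?Z = "\<lambda>k c. g (stopped B (position V r \<delta> S x0 c) k)"
  define F where "F c = ?Z (Suc k) c - ?Z k c + a * of_bool (alive k c)" for c
  have i: "integrable coins (?Z k)" for k
    by (rule integrable_coins_bounded[OF measurable_stopped bd])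
  have ia: "integrable coins (\<lambda>c. of_bool (alive k c) :: real)"
    by (rule integrable_coins_bounded[OF measurable_alive, of _ 1]) simp
  have "F c + F (c(k := \<not> c k)) \<le> 0" for c
  proof -
    let ?c = "c(k := \<not> c k)"
    have hc: "history V r \<delta> S x0 ?c k = history V r \<delta> S x0 c k"
      by (rule history_cong) auto
    have al: "alive k ?c = alive k c" by (simp add: alive_history hc)
    have st: "?Z k ?c = ?Z k c" unfolding stopped_history hc ..
    show ?thesis
    proof (cases "alive k c")
      case True
      have suc: "?Z (Suc k) c' = g (if c' k then S (history V r \<delta> S x0 c' k)
          else reflection V r \<delta> (position V r \<delta> S x0 c' k) (S (history V r \<delta> S x0 c' k)))"
        if "alive k c'" for c'
        using that unfolding alive_def by (simp add: position_def Let_def)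
      have "?Z (Suc k) c + ?Z (Suc k) ?c \<le> 2 * (g (position V r \<delta> S x0 c k) - a)"
      proof -
        have hp: "position V r \<delta> S x0 ?c k = position V r \<delta> S x0 c k"
          by (simp only: position_def hc)
        have ck: "?c k = (\<not> c k)" by simp
        show ?thesis
          unfolding suc[OF True] suc[OF al[THEN iffD2, OF True]] hc hp ck
          using step[OF True] by (cases "c k") simp_all
      qed
      moreover have "?Z k c = g (position V r \<delta> S x0 c k)"
        using True stopped_alive[of k _ B] by (simp add: alive_def)
      ultimately show ?thesis using True al st by (simp add: F_def)
    next
      case False
      have "?Z (Suc k) c' = ?Z k c'" if "\<not> alive k c'" for c'
        using that unfolding alive_def by auto
      then show ?thesis using False al by (simp add: F_def)
    qed
  qed
  moreover have "integrable coins F" unfolding F_def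
    by (intro Bochner_Integration.integrable_add Bochner_Integration.integrable_diff i
        integrable_mult_right ia)
  ultimately have "integral\<^sup>L coins F \<le> 0" by (rule integral_coins_nonpos[rotated])
  moreover have "integral\<^sup>L coins F = integral\<^sup>L coins (?Z (Suc k)) - integral\<^sup>L coins (?Z k)
      + a * integral\<^sup>L coins (\<lambda>c. of_bool (alive k c))"
    unfolding F_def using i[of "Suc k"] i[of k] ia
    by (simp del: stopped.simps)
  ultimately show ?thesis by simp
qed

text \<open>Survival probabilities decrease in \<open>k\<close>, so the drift accumulated over
  \<open>k\<close> steps is at least \<open>a * k\<close> times the last one. For bounded
  \<open>g\<close> this forces the survival probability to be of order \<open>1 / k\<close>.\<close>

lemma stopped_supermartingale:
  fixes g :: "real^'n::_ \<Rightarrow> real"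
  assumes bd: "\<And>x. \<bar>g x\<bar> \<le> M" and a: "0 \<le> a"
    and step: "\<And>c k. alive k c \<Longrightarrow> g (S (history V r \<delta> S x0 c k)) +
      g (reflection V r \<delta> (position V r \<delta> S x0 c k) (S (history V r \<delta> S x0 c k)))
      \<le> 2 * (g (position V r \<delta> S x0 c k) - a)"
  shows "integral\<^sup>L coins (\<lambda>c. g (stopped B (position V r \<delta> S x0 c) k))
    + a * real k * integral\<^sup>L coins (\<lambda>c. of_bool (alive k c)) \<le> g x0"
proof (induction k)
  case 0
  interpret prob_space coins by (rule prob_space_coins)
  show ?case by (simp add: position_def prob_space)
next
  case (Suc k)
  let ?p = "\<lambda>k. integral\<^sup>L coins (\<lambda>c. of_bool (alive k c) :: real)"
  have i: "integrable coins (\<lambda>c. of_bool (alive k c) :: real)" for k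
    by (rule integrable_coins_bounded[OF measurable_alive, of _ 1]) simp
  have "?p (Suc k) \<le> ?p k"
    by (rule integral_mono[OF i i]) (auto simp: alive_def)
  then have "a * real (Suc k) * ?p (Suc k) \<le> a * real (Suc k) * ?p k"
    using a by (intro mult_left_mono) auto
  then show ?case
    using Suc.IH supermartingale_step[of g M k a, OF bd step] by (simp add: algebra_simps)
qed

text \<open>Optional stopping by hand: up to time \<open>k\<close> the payoff is at most the stopped
  value of \<open>W\<close>, except on surviving paths. Their contribution is of order
  \<open>1 / k\<close> by \<open>stopped_supermartingale\<close>, and \<open>k\<close> tends to
  infinity.\<close>

lemma payoff_le_supersolution:
  fixes W f :: "real^'n::_ \<Rightarrow> real"
  assumes B: "finite B" and bd: "\<And>x. \<bar>W x\<bar> \<le> M" and a: "0 < a"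
    and step: "\<And>c k. alive k c \<Longrightarrow> W (S (history V r \<delta> S x0 c k)) +
      W (reflection V r \<delta> (position V r \<delta> S x0 c k) (S (history V r \<delta> S x0 c k)))
      \<le> 2 * (W (position V r \<delta> S x0 c k) - a)"
    and f: "\<And>b. b \<in> B \<Longrightarrow> f b \<le> W b"
  shows "integral\<^sup>L (game_law V r \<delta> S x0) (payoff B f) \<le> W x0"
proof -
  let ?p = "\<lambda>k. integral\<^sup>L coins (\<lambda>c. of_bool (alive k c) :: real)"
  let ?Z = "\<lambda>k. integral\<^sup>L coins (\<lambda>c. W (stopped B (position V r \<delta> S x0 c) k))"
  let ?J = "integral\<^sup>L coins (\<lambda>c. payoff B f (position V r \<delta> S x0 c))"
  \<comment> \<open>Bounds payoff minus \<open>W\<close> on surviving paths, where nothing relates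
    the two.\<close>
  define K where "K = M + (\<Sum>b\<in>B. \<bar>f b\<bar>)"
  interpret prob_space coins by (rule prob_space_coins)
  have i: "integrable coins (\<lambda>c. of_bool (alive k c) :: real)" for k
    by (rule integrable_coins_bounded[OF measurable_alive, of _ 1]) simp
  have iW: "integrable coins (\<lambda>c. W (stopped B (position V r \<delta> S x0 c) k))" for k
    by (rule integrable_coins_bounded[OF measurable_stopped bd])
  have iP: "integrable coins (\<lambda>c. payoff B f (position V r \<delta> S x0 c))"
    by (rule integrable_coins_bounded[OF measurable_compose[OF measurable_position
          measurable_payoff[OF B]] payoff_bound[OF B]])
  have K: "0 \<le> K" unfolding K_def using order_trans[OF abs_ge_zero bd] by (simp add: sum_nonneg)
  have M: "- M \<le> ?Z k" for k
  proof -
    have "integral\<^sup>L coins (\<lambda>_. - M) \<le> ?Z k"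
      by (rule integral_mono[OF _ iW]) (use bd in \<open>auto simp: abs_le_iff minus_le_iff\<close>)
    then show ?thesis by (simp add: prob_space)
  qed
  have sm: "?Z k + a * real k * ?p k \<le> W x0" for k
    by (rule stopped_supermartingale[OF bd _ step]) (use a in auto)
  have "?J \<le> W x0 + K * ((W x0 + M) / a) * inverse (real (Suc k))" for k
  proof -
    have pw: "payoff B f (position V r \<delta> S x0 c)
        \<le> W (stopped B (position V r \<delta> S x0 c) (Suc k)) + K * of_bool (alive (Suc k) c)" for c
    proof (cases "alive (Suc k) c")
      case True
      then show ?thesis
        using payoff_bound[OF B, of f "position V r \<delta> S x0 c"] bd[of "stopped B (position V r \<delta> S x0 c) (Suc k)"]
        by (simp add: K_def abs_le_iff del: stopped.simps)
    next
      case False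
      then have "\<not> (\<forall>j\<le>Suc k. position V r \<delta> S x0 c j \<notin> B)" by (simp add: alive_def)
      from payoff_stopped(1)[OF this, of f] payoff_stopped(2)[OF this] f False show ?thesis by (simp del: stopped.simps)
    qed
    have "?J \<le> integral\<^sup>L coins (\<lambda>c. W (stopped B (position V r \<delta> S x0 c) (Suc k)) + K * of_bool (alive (Suc k) c))"
      by (rule integral_mono[OF iP _ pw]) (intro Bochner_Integration.integrable_add iW integrable_mult_right i)
    also have "\<dots> = ?Z (Suc k) + K * ?p (Suc k)"
      using iW[of "Suc k"] i[of "Suc k"] by (simp del: stopped.simps)
    also have "\<dots> \<le> W x0 + K * ?p (Suc k)"
    proof -
      have "0 \<le> a * real (Suc k) * ?p (Suc k)" using a by (intro mult_nonneg_nonneg) auto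
      then show ?thesis using sm[of "Suc k"] by linarith
    qed
    also have "K * ?p (Suc k) \<le> K * ((W x0 + M) / a * inverse (real (Suc k)))"
    proof (rule mult_left_mono[OF _ K])
      define q where "q = ?p (Suc k)"
      have le: "a * real (Suc k) * q \<le> W x0 + M"
        using sm[of "Suc k"] M[of "Suc k"] unfolding q_def by linarith
      have pos: "0 < a * real (Suc k)" using a by simp
      have "q \<le> (W x0 + M) / (a * real (Suc k))"
        unfolding pos_le_divide_eq[OF pos] using le by (simp only: mult.commute[of q])
      then show "?p (Suc k) \<le> (W x0 + M) / a * inverse (real (Suc k))"
        unfolding q_def[symmetric] by (simp add: divide_inverse mult.assoc)
    qed
    finally show ?thesis by (simp add: mult.assoc)
  qed
  moreover have "(\<lambda>k. W x0 + K * ((W x0 + M) / a) * inverse (real (Suc k))) \<longlonglongrightarrow> W x0 + K * ((W x0 + M) / a) * 0"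
    by (intro tendsto_intros LIMSEQ_inverse_real_of_nat)
  ultimately have "?J \<le> W x0"
    using LIMSEQ_le_const[of _ "W x0 + K * ((W x0 + M) / a) * 0" ?J] by auto
  then show ?thesis by (simp add: integral_payoff[OF B])
qed

end

section \<open>Bounds on the game value\<close>

locale game_graph =
  fixes D V :: "(real^'n::{finite,linorder}) set" and r \<delta> :: real
  assumes finite_V: "finite V"
    and V_cube: "V \<subseteq> cbox 0 1"
    and connected: "largest_component V r = V"
    and outer_nbrs_ne: "\<And>x. x \<in> V \<Longrightarrow> outer_nbrs V r \<delta> x \<noteq> {}"
begin

lemma boundary_vertices_eq: "boundary_vertices D V r = V - D"
  using V_cube by (auto simp: boundary_vertices_def connected)

lemma outer_nbrs_subset: "outer_nbrs V r \<delta> x \<subseteq> V"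
  by (auto simp: outer_nbrs_def nbrs_def)

lemma strategiesI:
  assumes "\<And>h. h \<noteq> [] \<Longrightarrow> set h \<subseteq> V \<Longrightarrow> S h \<in> outer_nbrs V r \<delta> (last h)"
  shows "S \<in> strategies V r \<delta>"
  using assms by (simp add: strategies_def connected)

lemma strategies_outer:
  assumes "S \<in> strategies V r \<delta>" "h \<noteq> []" "set h \<subseteq> V"
  shows "S h \<in> outer_nbrs V r \<delta> (last h)"
  using assms by (simp add: strategies_def connected)

lemma history_subset:
  assumes S: "S \<in> strategies V r \<delta>" and x0: "x0 \<in> V"
  shows "set (history V r \<delta> S x0 c k) \<subseteq> V"
proof (induction k)
  case (Suc k)
  have "S (history V r \<delta> S x0 c k) \<in> outer_nbrs V r \<delta> (last (history V r \<delta> S x0 c k))"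
    using strategies_outer[OF S _ Suc] by simp
  then have "S (history V r \<delta> S x0 c k) \<in> V"
    "reflection V r \<delta> (last (history V r \<delta> S x0 c k)) (S (history V r \<delta> S x0 c k)) \<in> V"
    using reflection_in[OF finite_V] outer_nbrs_subset by blast+
  then show ?case using Suc by (simp add: Let_def)
qed (simp add: x0)

lemma position_in:
  assumes "S \<in> strategies V r \<delta>" "x0 \<in> V"
  shows "position V r \<delta> S x0 c k \<in> V"
  using history_subset[OF assms, of c k] by (auto simp: position_def)

lemma strategies_nonempty: "strategies V r \<delta> \<noteq> {}"
proof -
  have "(\<lambda>h. SOME y. y \<in> outer_nbrs V r \<delta> (last h)) \<in> strategies V r \<delta>"
    by (rule strategiesI) (use outer_nbrs_ne some_in_eq in \<open>auto dest!: last_in_set\<close>)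
  then show ?thesis by blast
qed

lemma payoff_le_strategy:
  fixes W f :: "real^'n::_ \<Rightarrow> real"
  assumes S: "S \<in> strategies V r \<delta>" and x0: "x0 \<in> V" and a: "0 < a"
    and step: "\<And>h. h \<noteq> [] \<Longrightarrow> set h \<subseteq> V \<Longrightarrow> last h \<in> D \<Longrightarrow>
      W (S h) + W (reflection V r \<delta> (last h) (S h)) \<le> 2 * (W (last h) - a)"
    and f: "\<And>b. b \<in> V - D \<Longrightarrow> f b \<le> W b"
  shows "integral\<^sup>L (game_law V r \<delta> S x0) (payoff (V - D) f) \<le> W x0"
proof -
  \<comment> \<open>\<open>W\<close> need not be bounded on the whole space; cut off outside the
    finite set \<open>V\<close>, which the game never leaves, it is.\<close>
  define W' where "W' x = (if x \<in> V then W x else 0)" for x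
  have "integral\<^sup>L (game_law V r \<delta> S x0) (payoff (V - D) f) \<le> W' x0"
  proof (rule payoff_le_supersolution[where W = W' and B = "V - D", OF _ _ a])
    show "\<bar>W' x\<bar> \<le> (\<Sum>v\<in>V. \<bar>W v\<bar>)" for x
      using member_le_sum[of x V "\<lambda>v. \<bar>W v\<bar>"] finite_V by (auto simp: W'_def sum_nonneg)
    fix c k assume "alive V r \<delta> S x0 (V - D) k c"
    then have D: "position V r \<delta> S x0 c k \<in> D"
      using position_in[OF S x0, of c k] by (auto simp: alive_def)
    let ?h = "history V r \<delta> S x0 c k"
    have h: "?h \<noteq> []" "set ?h \<subseteq> V" using history_subset[OF S x0] by auto
    have o: "S ?h \<in> outer_nbrs V r \<delta> (last ?h)" by (rule strategies_outer[OF S h])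
    show "W' (S ?h) + W' (reflection V r \<delta> (position V r \<delta> S x0 c k) (S ?h))
        \<le> 2 * (W' (position V r \<delta> S x0 c k) - a)"
      using step[OF h] D o reflection_in[OF finite_V o] outer_nbrs_subset position_in[OF S x0, of c k]
      by (auto simp: W'_def position_def)
  qed (use finite_V f in \<open>auto simp: W'_def\<close>)
  then show ?thesis using x0 by (simp add: W'_def)
qed

lemma payoff_ge_strategy:
  fixes W f :: "real^'n::_ \<Rightarrow> real"
  assumes S: "S \<in> strategies V r \<delta>" and x0: "x0 \<in> V" and a: "0 < a"
    and step: "\<And>h. h \<noteq> [] \<Longrightarrow> set h \<subseteq> V \<Longrightarrow> last h \<in> D \<Longrightarrow>
      W (S h) + W (reflection V r \<delta> (last h) (S h)) \<ge> 2 * (W (last h) + a)"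
    and f: "\<And>b. b \<in> V - D \<Longrightarrow> f b \<ge> W b"
  shows "integral\<^sup>L (game_law V r \<delta> S x0) (payoff (V - D) f) \<ge> W x0"
proof -
  have "integral\<^sup>L (game_law V r \<delta> S x0) (payoff (V - D) (\<lambda>x. - f x)) \<le> - W x0"
    by (rule payoff_le_strategy[OF S x0 a]) (use step f in force)+
  then show ?thesis by (simp add: payoff_uminus)
qed

text \<open>The inequality is required for all moves \<open>y\<close>, so that \<open>W\<close>
  becomes a submartingale under every strategy, whatever history it uses.\<close>

lemma game_value_ge:
  fixes W f :: "real^'n::_ \<Rightarrow> real"
  assumes x0: "x0 \<in> V" and a: "0 < a"
    and step: "\<And>x y. x \<in> V \<inter> D \<Longrightarrow> y \<in> outer_nbrs V r \<delta> x \<Longrightarrow>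
      W y + W (reflection V r \<delta> x y) \<ge> 2 * (W x + a)"
    and f: "\<And>b. b \<in> V - D \<Longrightarrow> f b \<ge> W b"
  shows "game_value D f V r \<delta> x0 \<ge> W x0"
  unfolding game_value_def boundary_vertices_eq
proof (rule cINF_greatest[OF strategies_nonempty])
  fix S assume S: "S \<in> strategies V r \<delta>"
  show "W x0 \<le> integral\<^sup>L (game_law V r \<delta> S x0) (payoff (V - D) f)"
    by (rule payoff_ge_strategy[OF S x0 a _ f])
       (use step strategies_outer[OF S] last_in_set in blast)+
qed

text \<open>One favourable move per vertex of \<open>D\<close> suffices: always playing it is a
  strategy that looks only at the current position, and its expected payoff bounds the infimum from
  above.\<close>

lemma game_value_le:
  fixes W f :: "real^'n::_ \<Rightarrow> real"
  assumes x0: "x0 \<in> V" and a: "0 < a"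
    and step: "\<And>x. x \<in> V \<inter> D \<Longrightarrow> \<exists>y\<in>outer_nbrs V r \<delta> x.
      W y + W (reflection V r \<delta> x y) \<le> 2 * (W x - a)"
    and f: "\<And>b. b \<in> V - D \<Longrightarrow> f b \<le> W b"
  shows "game_value D f V r \<delta> x0 \<le> W x0"
proof -
  \<comment> \<open>Outside \<open>D\<close> any outer neighbour will do; the implication lets one
    choice function cover all of \<open>V\<close>, since strategies must also be admissible
    there.\<close>
  have "\<exists>y\<in>outer_nbrs V r \<delta> x.
      x \<in> D \<longrightarrow> W y + W (reflection V r \<delta> x y) \<le> 2 * (W x - a)" if "x \<in> V" for x
    using step[of x] outer_nbrs_ne[OF that] that by auto
  then obtain s where s: "\<And>x. x \<in> V \<Longrightarrow> s x \<in> outer_nbrs V r \<delta> x"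
    "\<And>x. x \<in> V \<Longrightarrow> x \<in> D \<Longrightarrow> W (s x) + W (reflection V r \<delta> x (s x)) \<le> 2 * (W x - a)"
    by metis
  have S: "(\<lambda>h. s (last h)) \<in> strategies V r \<delta>"
    by (rule strategiesI) (meson last_in_set s(1) subsetD)
  \<comment> \<open>Needed because \<open>INF\<close> of an unbounded set of reals would say
    nothing.\<close>
  have "bdd_below ((\<lambda>S. integral\<^sup>L (game_law V r \<delta> S x0) (payoff (V - D) f)) ` strategies V r \<delta>)"
  proof (rule bdd_belowI2)
    fix S
    interpret prob_space coins by (rule prob_space_coins)
    have fin: "finite (V - D)" using finite_V by simp
    have "expectation (\<lambda>_. - (\<Sum>b\<in>V - D. \<bar>f b\<bar>))
        \<le> expectation (\<lambda>c. payoff (V - D) f (position V r \<delta> S x0 c))"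
    proof (rule integral_mono)
      show "integrable coins (\<lambda>c. payoff (V - D) f (position V r \<delta> S x0 c))"
        by (rule integrable_coins_bounded[OF measurable_compose[OF measurable_position
              measurable_payoff[OF fin]] payoff_bound[OF fin]])
      show "- (\<Sum>b\<in>V - D. \<bar>f b\<bar>) \<le> payoff (V - D) f (position V r \<delta> S x0 c)" for c
        using payoff_bound[OF fin, of f "position V r \<delta> S x0 c"] by linarith
    qed simp
    then show "- (\<Sum>b\<in>V - D. \<bar>f b\<bar>) \<le> integral\<^sup>L (game_law V r \<delta> S x0) (payoff (V - D) f)"
      by (simp add: integral_payoff[OF fin] prob_space)
  qed
  then have "game_value D f V r \<delta> x0
      \<le> integral\<^sup>L (game_law V r \<delta> (\<lambda>h. s (last h)) x0) (payoff (V - D) f)"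
    unfolding game_value_def boundary_vertices_eq by (rule cINF_lower[OF _ S])
  also have "\<dots> \<le> W x0"
    by (rule payoff_le_strategy[OF S x0 a _ f]) (use s(2) last_in_set in blast)+
  finally show ?thesis .
qed

end

lemma game_graph_eps_dense:
  fixes V :: "(real^'n::{finite,linorder}) set"
  assumes "eps_dense \<epsilon> V" "4 * \<epsilon> \<le> \<delta> * r" "\<delta> \<le> 1/2" "0 < \<epsilon>" "0 < r" "r \<le> 1/2"
  shows "game_graph V r \<delta>"
proof
  have "\<delta> * r \<le> r" using assms by (simp add: mult_left_le_one_le mult.commute)
  then show "largest_component V r = V"
    using largest_component_eps_dense assms by (meson order_trans)
  show "x \<in> V \<Longrightarrow> outer_nbrs V r \<delta> x \<noteq> {}" for x
    using outer_nbrs_nonempty[OF assms] assms(1) by (auto simp: eps_dense_def)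
qed (use assms in \<open>auto simp: eps_dense_def\<close>)

text \<open>Adding a small multiple of the squared norm makes the perturbed functions strict discrete
  sub- and supersolutions, because an almost symmetric step increases the squared norm by about
  \<open>r\<^sup>2\<close>.\<close>

lemma norm_square_step:
  fixes x y z :: "'a::real_inner"
  assumes "r / 2 \<le> norm (y - x)" "r / 2 \<le> norm (z - x)" "norm (z + y - 2 *\<^sub>R x) \<le> 3 * \<epsilon>"
    and "norm x \<le> N" "0 \<le> N" "0 < r" "24 * N * \<epsilon> \<le> r\<^sup>2"
  shows "(norm y)\<^sup>2 + (norm z)\<^sup>2 \<ge> 2 * (norm x)\<^sup>2 + r\<^sup>2 / 4"
proof -
  have "(norm y)\<^sup>2 + (norm z)\<^sup>2 - 2 * (norm x)\<^sup>2
      = (norm (y - x))\<^sup>2 + (norm (z - x))\<^sup>2 + 2 * (x \<bullet> (z + y - 2 *\<^sub>R x))"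
    by (simp add: power2_norm_eq_inner inner_simps inner_commute)
  moreover have "(r / 2)\<^sup>2 \<le> (norm (y - x))\<^sup>2" "(r / 2)\<^sup>2 \<le> (norm (z - x))\<^sup>2"
    using assms by (auto intro!: power_mono)
  moreover have "\<bar>x \<bullet> (z + y - 2 *\<^sub>R x)\<bar> \<le> N * (3 * \<epsilon>)"
    using Cauchy_Schwarz_ineq2[of x "z + y - 2 *\<^sub>R x"]
      mult_mono[OF assms(4,3,5)] by simp
  moreover have "(r / 2)\<^sup>2 = r\<^sup>2 / 4" by (simp add: power_divide)
  moreover have "N * (3 * \<epsilon>) \<le> r\<^sup>2 / 8" using assms(7) by simp
  ultimately show ?thesis by linarith
qed

lemma norm_cube_le:
  fixes x :: "real^'n"
  assumes "x \<in> cbox 0 1"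
  shows "norm x \<le> real CARD('n)"
proof -
  have "norm x \<le> (\<Sum>i\<in>UNIV. \<bar>x $ i\<bar>)" by (rule norm_le_l1_cart)
  also have "\<dots> \<le> (\<Sum>i\<in>(UNIV :: 'n set). 1)"
    using assms by (intro sum_mono) (auto simp: mem_box_cart)
  finally show ?thesis by simp
qed

text \<open>The deterministic core: \<open>W1\<close> and \<open>W2\<close> are compared with the
  game value. The shift by \<open>2 * \<kappa>\<close> orders them against \<open>f\<close> on
  boundary vertices near \<open>D\<close>: one \<open>\<kappa>\<close> covers the gap between
  \<open>g\<close> and \<open>f\<close>, the other the quadratic term. Passing from \<open>x\<close>
  to its closest vertex and from \<open>g\<close> to \<open>u\<close> costs another
  \<open>2 * \<kappa>\<close>, whence the bound \<open>4 * \<kappa>\<close>.\<close>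

lemma extended_value_near:
  fixes D V :: "(real^'n::{finite,linorder}) set" and f u g :: "real^'n::_ \<Rightarrow> real"
    and \<epsilon> r \<delta> L \<rho> \<kappa> :: real
  defines "N \<equiv> real CARD('n)"
  assumes V: "eps_dense \<epsilon> V" and p: "4 * \<epsilon> \<le> \<delta> * r" "\<delta> \<le> 1/2" "0 < \<epsilon>" "0 < r" "r \<le> 1/2" "r \<le> \<rho>"
    and \<epsilon>: "24 * N * \<epsilon> \<le> r\<^sup>2" "72 * L * \<epsilon> * N\<^sup>2 \<le> \<kappa> * r\<^sup>2"
    and \<kappa>: "0 < \<kappa>" and L: "0 < L"
    and D: "\<And>x. x \<in> D \<Longrightarrow> cball x r \<subseteq> cbox 0 1"
    and g_u: "\<And>x. x \<in> D \<Longrightarrow> \<bar>g x - u x\<bar> \<le> \<kappa>"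
    and g_f: "\<And>x y. x \<in> cbox 0 1 - D \<Longrightarrow> y \<in> D \<Longrightarrow> dist x y \<le> \<rho> \<Longrightarrow> \<bar>g x - f x\<bar> \<le> \<kappa>"
    and g_lip: "\<And>x y z. x \<in> D \<Longrightarrow> y \<in> cball x \<rho> \<Longrightarrow> z \<in> cball x \<rho> \<Longrightarrow> \<bar>g y - g z\<bar> \<le> L * norm (y - z)"
    and g_mid: "\<And>x y z. x \<in> D \<Longrightarrow> y \<in> cball x \<rho> \<Longrightarrow> z \<in> cball x \<rho> \<Longrightarrow>
      2 * g ((1/2) *\<^sub>R y + (1/2) *\<^sub>R z) \<le> g y + g z"
    and g_flat: "\<And>x. x \<in> D \<Longrightarrow> \<exists>z. norm z = 1 \<and>
      (\<forall>t. 0 \<le> t \<and> t \<le> \<rho> \<longrightarrow> g (x + t *\<^sub>R z) + g (x - t *\<^sub>R z) \<le> 2 * g x)"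
    and x: "x \<in> D"
  shows "\<bar>extended_value D f V r \<delta> x - u x\<bar> \<le> 4 * \<kappa>"
proof -
  interpret game_graph D V r \<delta> by (rule game_graph_eps_dense[OF V p(1-5)])
  have N: "N > 0" by (simp add: N_def)
  \<comment> \<open>Norms in the cube are at most \<open>N\<close>, so the quadratic term never
    exceeds \<open>\<kappa>\<close> on the vertices.\<close>
  define \<eta> where "\<eta> = \<kappa> / N\<^sup>2"
  have \<eta>: "\<eta> > 0" "\<eta> * N\<^sup>2 = \<kappa>" using \<kappa> N by (auto simp: \<eta>_def)
  have L\<epsilon>: "72 * L * \<epsilon> \<le> \<eta> * r\<^sup>2"
    using \<epsilon>(2) N by (simp add: \<eta>_def pos_le_divide_eq)
  have \<eta>_sq: "0 \<le> \<eta> * (norm v)\<^sup>2" "\<eta> * (norm v)\<^sup>2 \<le> \<kappa>" if "v \<in> V" for v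
  proof -
    have "norm v \<le> N" using norm_cube_le[of v] that V_cube by (auto simp: N_def)
    then have "(norm v)\<^sup>2 \<le> N\<^sup>2" by (intro power_mono) auto
    then have "\<eta> * (norm v)\<^sup>2 \<le> \<eta> * N\<^sup>2" using \<eta>(1) by (intro mult_left_mono) auto
    then show "\<eta> * (norm v)\<^sup>2 \<le> \<kappa>" by (simp only: \<eta>(2))
    show "0 \<le> \<eta> * (norm v)\<^sup>2" using \<eta>(1) by simp
  qed
  have r\<epsilon>: "6 * \<epsilon> \<le> r"
  proof -
    have "\<delta> * r \<le> 1 / 2 * r" using p by (intro mult_right_mono) auto
    then show ?thesis using p by linarith
  qed
  \<comment> \<open>The quadratic gain of one step is \<open>4 * a\<close>: half of it pays for the
    Lipschitz errors of \<open>g\<close>, at most \<open>L * (9 * \<epsilon>)\<close>, and half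
    remains as drift \<open>a\<close> in the averaged inequality. The constant 72 in the hypotheses
    is 8 times 9.\<close>
  define a where "a = \<eta> * r\<^sup>2 / 16"
  have a: "a > 0" using \<eta>(1) p by (simp add: a_def)
  \<comment> \<open>Nothing is known about \<open>g\<close> farther than \<open>\<rho>\<close> from
    \<open>D\<close>. There the comparison functions are set to \<open>f\<close>; a move from
    \<open>D\<close> has length below \<open>r \<le> \<rho>\<close> and cannot reach these
    points.\<close>
  define near where "near v \<longleftrightarrow> (\<exists>y\<in>D. dist v y \<le> \<rho>)" for v
  have near_D: "near v" if "v \<in> D" for v
    using that p by (auto simp: near_def intro!: bexI[of _ v])
  have outer: "v \<in> V" "near v" "v \<in> cball y \<rho>" "r / 2 \<le> norm (v - y)"
    if "v \<in> outer_nbrs V r \<delta> y" "y \<in> D" for v y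
  proof -
    have v: "v \<in> V" "norm (y - v) < r" "(1 - \<delta>) * r < norm (y - v)"
      using that(1) by (auto simp: outer_nbrs_def nbrs_def)
    have "1 / 2 * r \<le> (1 - \<delta>) * r" using p by (intro mult_right_mono) auto
    then show "r / 2 \<le> norm (v - y)" using v(3) by (simp add: norm_minus_commute)
    show "v \<in> V" by (rule v(1))
    show "v \<in> cball y \<rho>" using v(2) p by (simp add: dist_norm)
    then show "near v" using that(2) by (auto simp: near_def dist_commute)
  qed
  have sq: "2 * (\<eta> * (norm y)\<^sup>2) + 4 * a \<le> \<eta> * (norm v)\<^sup>2 + \<eta> * (norm v')\<^sup>2"
    and refl: "v' \<in> outer_nbrs V r \<delta> y" "norm (v' + v - 2 *\<^sub>R y) \<le> 3 * \<epsilon>"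
    if "v \<in> outer_nbrs V r \<delta> y" "y \<in> V" "y \<in> D" "v' = reflection V r \<delta> y v" for v v' y
  proof -
    show 1: "v' \<in> outer_nbrs V r \<delta> y" using reflection_in[OF finite_V that(1)] that(4) by simp
    show 2: "norm (v' + v - 2 *\<^sub>R y) \<le> 3 * \<epsilon>"
      using reflection_near[OF V p(1-4) D[OF that(3)] that(1)] that(4) by simp
    have "2 * (norm y)\<^sup>2 + r\<^sup>2 / 4 \<le> (norm v)\<^sup>2 + (norm v')\<^sup>2"
    proof (rule norm_square_step[OF _ _ 2 _ _ p(4) \<epsilon>(1)])
      show "norm y \<le> N" using norm_cube_le[of y] that(2) V_cube by (auto simp: N_def)
    qed (use outer(4)[OF that(1,3)] outer(4)[OF 1 that(3)] N in auto)
    then have "\<eta> * (2 * (norm y)\<^sup>2 + r\<^sup>2 / 4) \<le> \<eta> * ((norm v)\<^sup>2 + (norm v')\<^sup>2)"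
      using \<eta>(1) by (intro mult_left_mono) auto
    then show "2 * (\<eta> * (norm y)\<^sup>2) + 4 * a \<le> \<eta> * (norm v)\<^sup>2 + \<eta> * (norm v')\<^sup>2"
      by (simp add: a_def algebra_simps)
  qed
  have L\<epsilon>a: "L * (9 * \<epsilon>) \<le> 2 * a" using L\<epsilon> by (simp add: a_def)

  define x0 where "x0 = closest_vertex V x"
  have x_cube: "x \<in> cbox 0 1" using D[OF x] p by auto
  have x0: "x0 \<in> V" "norm (x0 - x) \<le> \<epsilon>"
    using closest_vertex_near[OF V x_cube] by (auto simp: x0_def)
  have x0_near: "near x0" "x0 \<in> cball x \<rho>"
    using x0 x r\<epsilon> p by (auto simp: near_def dist_norm norm_minus_commute intro!: bexI[of _ x])
  have "\<bar>g x0 - g x\<bar> \<le> L * norm (x0 - x)"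
    by (rule g_lip[OF x x0_near(2)]) (use p in auto)
  also have "\<dots> \<le> L * \<epsilon>" using x0 L by simp
  also have "L * \<epsilon> \<le> \<kappa>"
  proof -
    have "\<eta> \<le> \<kappa>" unfolding \<eta>_def using \<kappa> N
      by (simp add: N_def divide_le_eq mult_le_cancel_left1)
    moreover have "r\<^sup>2 \<le> 1" using p by (intro power_le_one) auto
    ultimately have "\<eta> * r\<^sup>2 \<le> \<kappa> * 1" using \<eta> \<kappa> by (intro mult_mono) auto
    then show ?thesis using L\<epsilon> mult_pos_pos[OF L p(3)] by linarith
  qed
  finally have gx0: "\<bar>g x0 - u x\<bar> \<le> 2 * \<kappa>" using g_u[OF x] by linarith

  define W1 where "W1 v = (if near v then g v - 2 * \<kappa> + \<eta> * (norm v)\<^sup>2 else f v)" for v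
  have "W1 x0 \<le> game_value D f V r \<delta> x0"
  proof (rule game_value_ge[OF x0(1) a])
    fix y v assume y: "y \<in> V \<inter> D" and v: "v \<in> outer_nbrs V r \<delta> y"
    define v' where "v' = reflection V r \<delta> y v"
    have v': "v' \<in> outer_nbrs V r \<delta> y" "norm (v' + v - 2 *\<^sub>R y) \<le> 3 * \<epsilon>"
      using refl[OF v _ _ v'_def] y by auto
    \<comment> \<open>Convexity applies at the midpoint of the two possible moves, which misses
      \<open>y\<close> by at most \<open>3 / 2 * \<epsilon>\<close>.\<close>
    let ?m = "(1/2) *\<^sub>R v + (1/2) *\<^sub>R v'"
    have "y - ?m = - ((1/2) *\<^sub>R (v' + v - 2 *\<^sub>R y))" by (simp add: algebra_simps)
    then have my: "norm (y - ?m) \<le> 3 / 2 * \<epsilon>" using v'(2) by simp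
    then have "?m \<in> cball y \<rho>" using r\<epsilon> p by (simp add: dist_norm)
    then have "\<bar>g y - g ?m\<bar> \<le> L * norm (y - ?m)" using y p by (intro g_lip) auto
    also have "\<dots> \<le> L * (3 / 2 * \<epsilon>)" using my L by (intro mult_left_mono) auto
    finally have "g y - L * (3 / 2 * \<epsilon>) \<le> g ?m" by linarith
    moreover have "2 * g ?m \<le> g v + g v'"
      using outer(3)[OF v] outer(3)[OF v'(1)] y by (intro g_mid) auto
    moreover have "0 < L * \<epsilon>" using L p by simp
    ultimately have "2 * g y - 2 * a \<le> g v + g v'" using L\<epsilon>a by linarith
    then show "2 * (W1 y + a) \<le> W1 v + W1 (reflection V r \<delta> y v)"
      using sq[OF v _ _ v'_def] y outer(2)[OF v] outer(2)[OF v'(1)] near_D[of y]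
      by (simp add: W1_def v'_def[symmetric])
  next
    fix b assume b: "b \<in> V - D"
    show "W1 b \<le> f b"
    proof (cases "near b")
      case True
      then have "\<bar>g b - f b\<bar> \<le> \<kappa>" using g_f[of b] b V_cube by (auto simp: near_def)
      then show ?thesis using True \<eta>_sq[of b] b by (simp add: W1_def)
    qed (simp add: W1_def)
  qed
  then have 1: "g x0 - 2 * \<kappa> \<le> extended_value D f V r \<delta> x"
    using x0_near(1) \<eta>_sq[OF x0(1)] by (simp add: W1_def extended_value_def x0_def)

  define W2 where "W2 v = (if near v then g v + 2 * \<kappa> - \<eta> * (norm v)\<^sup>2 else f v)" for v
  have "game_value D f V r \<delta> x0 \<le> W2 x0"
  proof (rule game_value_le[OF x0(1) a])
    fix y assume "y \<in> V \<inter> D"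
    then have y: "y \<in> V" "y \<in> D" by auto
    obtain z where z: "norm z = 1"
      "\<And>t. 0 \<le> t \<Longrightarrow> t \<le> \<rho> \<Longrightarrow> g (y + t *\<^sub>R z) + g (y - t *\<^sub>R z) \<le> 2 * g y"
      using g_flat[OF y(2)] by blast
    obtain v where v: "v \<in> outer_nbrs V r \<delta> y" "norm (v - (y + r *\<^sub>R z)) \<le> 3 * \<epsilon>"
    proof (rule outer_nbrs_near_interior[OF V p(1-4) D[OF y(2)], of "y + r *\<^sub>R z"])
      have "0 \<le> \<delta> * r" using p by linarith
      then show "(1 - \<delta>) * r \<le> norm (y + r *\<^sub>R z - y)" using z p by (simp add: algebra_simps)
    qed (use z p in auto)
    define v' where "v' = reflection V r \<delta> y v"
    have v': "v' \<in> outer_nbrs V r \<delta> y" "norm (v' + v - 2 *\<^sub>R y) \<le> 3 * \<epsilon>"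
      using refl[OF v(1) y v'_def] by auto
    \<comment> \<open>The errors add up: \<open>v\<close> misses the end of the flat segment by
      \<open>3 * \<epsilon>\<close> and the reflection is inexact by \<open>3 * \<epsilon>\<close>,
      so \<open>v'\<close> misses the opposite end by at most \<open>6 * \<epsilon>\<close>.\<close>
    have e: "v' - (y - r *\<^sub>R z) = (v' + v - 2 *\<^sub>R y) - (v - (y + r *\<^sub>R z))"
      by (simp add: algebra_simps scaleR_2)
    have "norm (v' - (y - r *\<^sub>R z)) \<le> 3 * \<epsilon> + 3 * \<epsilon>"
      unfolding e by (rule order_trans[OF norm_triangle_ineq4 add_mono[OF v'(2) v(2)]])
    then have "L * norm (v' - (y - r *\<^sub>R z)) \<le> L * (6 * \<epsilon>)" using L by simp
    moreover have "\<bar>g v' - g (y - r *\<^sub>R z)\<bar> \<le> L * norm (v' - (y - r *\<^sub>R z))"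
      by (rule g_lip[OF y(2) outer(3)[OF v'(1) y(2)]]) (use z p in \<open>auto simp: dist_norm\<close>)
    moreover have "\<bar>g v - g (y + r *\<^sub>R z)\<bar> \<le> L * norm (v - (y + r *\<^sub>R z))"
      by (rule g_lip[OF y(2) outer(3)[OF v(1) y(2)]]) (use z p in \<open>auto simp: dist_norm\<close>)
    moreover have "L * norm (v - (y + r *\<^sub>R z)) \<le> L * (3 * \<epsilon>)" using v(2) L by simp
    moreover have "g (y + r *\<^sub>R z) + g (y - r *\<^sub>R z) \<le> 2 * g y" using p by (intro z(2)) auto
    ultimately have "g v + g v' \<le> 2 * g y + 2 * a" using L\<epsilon>a by linarith
    then have "W2 v + W2 (reflection V r \<delta> y v) \<le> 2 * (W2 y - a)"
      using sq[OF v(1) y v'_def] outer(2)[OF v(1) y(2)] outer(2)[OF v'(1) y(2)] near_D[OF y(2)]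
      by (simp add: W2_def v'_def[symmetric])
    then show "\<exists>v\<in>outer_nbrs V r \<delta> y. W2 v + W2 (reflection V r \<delta> y v) \<le> 2 * (W2 y - a)"
      using v(1) by blast
  next
    fix b assume b: "b \<in> V - D"
    show "f b \<le> W2 b"
    proof (cases "near b")
      case True
      then have "\<bar>g b - f b\<bar> \<le> \<kappa>" using g_f[of b] b V_cube by (auto simp: near_def)
      then show ?thesis using True \<eta>_sq[of b] b by (simp add: W2_def)
    qed (simp add: W2_def)
  qed
  then have "extended_value D f V r \<delta> x \<le> g x0 + 2 * \<kappa>"
    using x0_near(1) \<eta>_sq[OF x0(1)] by (simp add: W2_def extended_value_def x0_def)
  then show ?thesis using 1 gx0 by linarith
qed

section \<open>Convexity and flat directions of the viscosity solution\<close>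

lemma bdd_below_quadratic_form:
  fixes M :: "real^'n^'n"
  shows "bdd_below ((\<lambda>z. (M *v z) \<bullet> z) ` sphere 0 1)"
proof -
  have "compact ((\<lambda>z. (M *v z) \<bullet> z) ` sphere 0 1)"
    by (intro compact_continuous_image continuous_intros linear_continuous_on
        matrix_vector_mul_bounded_linear compact_sphere)
  then show ?thesis by (intro bounded_imp_bdd_below compact_imp_bounded)
qed

lemma lambda1_le: "norm z = 1 \<Longrightarrow> lambda1 M \<le> (M *v z) \<bullet> z"
  unfolding lambda1_def by (rule cINF_lower[OF bdd_below_quadratic_form]) simp

lemma lambda1_ge:
  fixes M :: "real^'n^'n"
  assumes "\<And>z. norm z = 1 \<Longrightarrow> c \<le> (M *v z) \<bullet> z"
  shows "c \<le> lambda1 M"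
  unfolding lambda1_def
proof (rule cINF_greatest)
  have "axis undefined 1 \<in> (sphere 0 1 :: (real^'n) set)" by simp
  then show "(sphere 0 1 :: (real^'n) set) \<noteq> {}" by blast
qed (use assms in simp)

text \<open>The Hessian of \<open>\<beta> * ((x - p) \<bullet> (x - p)) + \<gamma> * (e \<bullet> (x
  - p))\<^sup>2\<close>, given through its linear map. Both viscosity arguments use test functions
  of this kind.\<close>

definition quad_hess :: "real \<Rightarrow> real \<Rightarrow> real^'n \<Rightarrow> real^'n^'n" where
  "quad_hess \<beta> \<gamma> e = matrix (\<lambda>h. (2 * \<beta>) *\<^sub>R h + (2 * \<gamma> * (e \<bullet> h)) *\<^sub>R e)"

lemma quad_hess_mult: "quad_hess \<beta> \<gamma> e *v h = (2 * \<beta>) *\<^sub>R h + (2 * \<gamma> * (e \<bullet> h)) *\<^sub>R e"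
proof -
  have "linear (\<lambda>h. (2 * \<beta>) *\<^sub>R h + (2 * \<gamma> * (e \<bullet> h)) *\<^sub>R e)"
    by (rule linearI) (simp_all add: algebra_simps inner_add_right)
  from matrix_vector_mul(2)[OF this] show ?thesis unfolding quad_hess_def by metis
qed

lemma C2_on_quadratic:
  "C2_on U (\<lambda>x. \<alpha> + b \<bullet> (x - p) + \<beta> * ((x - p) \<bullet> (x - p)) + \<gamma> * (e \<bullet> (x - p))\<^sup>2)
     (\<lambda>_. quad_hess \<beta> \<gamma> e)"
  unfolding C2_on_def
proof (intro exI[of _ "\<lambda>x. b + (2 * \<beta>) *\<^sub>R (x - p) + (2 * \<gamma> * (e \<bullet> (x - p))) *\<^sub>R e"] conjI ballI)
  fix x
  show "((\<lambda>x. \<alpha> + b \<bullet> (x - p) + \<beta> * ((x - p) \<bullet> (x - p)) + \<gamma> * (e \<bullet> (x - p))\<^sup>2) has_derivative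
     (\<lambda>h. (b + (2 * \<beta>) *\<^sub>R (x - p) + (2 * \<gamma> * (e \<bullet> (x - p))) *\<^sub>R e) \<bullet> h)) (at x)"
    by (auto intro!: derivative_eq_intros simp: algebra_simps inner_simps inner_commute fun_eq_iff)
  show "((\<lambda>x. b + (2 * \<beta>) *\<^sub>R (x - p) + (2 * \<gamma> * (e \<bullet> (x - p))) *\<^sub>R e) has_derivative
     (\<lambda>h. quad_hess \<beta> \<gamma> e *v h)) (at x)"
    unfolding quad_hess_mult
    by (auto intro!: derivative_eq_intros simp: fun_eq_iff)
qed simp

text \<open>If \<open>u\<close> exceeds a chord by \<open>G\<close> at \<open>x0\<close>, then on a
  thin cylinder around the segment \<open>u\<close> can be touched from above by a function that is
  strictly concave along the segment and steep across it. Its Hessian is negative in the direction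
  \<open>E\<close>, so \<open>lambda1\<close> is negative, against the subsolution property.\<close>

lemma subsolution_imp_convex_on:
  fixes u :: "real^'n \<Rightarrow> real"
  assumes D: "open D" "convex D" and cont: "continuous_on D u" and sub: "viscosity_subsolution D u"
  shows "convex_on D u"
proof (rule convex_onI)
  fix t0 :: real and a b assume t0: "0 < t0" "t0 < 1" and ab: "a \<in> D" "b \<in> D"
  define x0 where "x0 = (1 - t0) *\<^sub>R a + t0 *\<^sub>R b"
  define E where "E = b - a"
  define G where "G = u x0 - ((1 - t0) * u a + t0 * u b)"
  show "u ((1 - t0) *\<^sub>R a + t0 *\<^sub>R b) \<le> (1 - t0) * u a + t0 * u b"
  proof (rule ccontr)
    assume "\<not> ?thesis"
    then have G: "G > 0" by (simp add: G_def x0_def)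
    have E: "E \<noteq> 0"
    proof
      assume "E = 0"
      then have "a = b" by (simp add: E_def)
      moreover have "(1 - t0) *\<^sub>R b + t0 *\<^sub>R b = b" by (simp add: algebra_simps)
      moreover have "(1 - t0) * u b + t0 * u b = u b" by (simp add: algebra_simps)
      ultimately show False using G by (simp add: G_def x0_def)
    qed
    \<comment> \<open>\<open>T\<close> is the coordinate along the line, 0 at \<open>a\<close> and 1
      at \<open>b\<close>; \<open>q\<close> is the squared distance from the line.\<close>
    define T where "T x = (E \<bullet> (x - a)) / (E \<bullet> E)" for x
    define q where "q x = (norm (x - a - T x *\<^sub>R E))\<^sup>2" for x
    have EE: "E \<bullet> E > 0" using E by simp
    have T_cont [continuous_intros]: "continuous_on S T" for S
      unfolding T_def using EE by (intro continuous_intros) auto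
    have q_cont [continuous_intros]: "continuous_on S q" for S
      unfolding q_def by (intro continuous_intros)
    have seg: "closed_segment a b \<subseteq> D" using ab D(2) by (simp add: closed_segment_subset)
    obtain s1 where s1: "s1 > 0" "(\<Union>x\<in>closed_segment a b. ball x s1) \<subseteq> D"
      using compact_subset_open_imp_ball_epsilon_subset[OF compact_segment D(1) seg] by blast
    have near: "\<exists>s>0. \<forall>x. dist x p \<le> s \<longrightarrow> u x \<le> u p + G / 4" if "p \<in> D" for p
    proof -
      have "isCont u p" using cont that D(1) by (simp add: continuous_on_eq_continuous_at)
      then obtain d where d: "d > 0" "\<And>x. dist x p < d \<Longrightarrow> dist (u x) (u p) < G / 4"
        unfolding continuous_at_eps_delta using G by (metis zero_less_divide_iff zero_less_numeral)
      have "u x \<le> u p + G / 4" if "dist x p \<le> d / 2" for x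
      proof -
        have "\<bar>u x - u p\<bar> < G / 4" using d(2)[of x] d(1) that by (simp add: dist_real_def)
        then show ?thesis by linarith
      qed
      then show ?thesis using d(1) by (intro exI[of _ "d / 2"]) auto
    qed
    obtain s2 where s2: "s2 > 0" "\<And>x. dist x a \<le> s2 \<Longrightarrow> u x \<le> u a + G / 4" using near[OF ab(1)] by blast
    obtain s3 where s3: "s3 > 0" "\<And>x. dist x b \<le> s3 \<Longrightarrow> u x \<le> u b + G / 4" using near[OF ab(2)] by blast
    define s where "s = min (s1 / 2) (min s2 s3)"
    have s: "s > 0" "s < s1" "s \<le> s2" "s \<le> s3" using s1 s2 s3 by (auto simp: s_def)
    define C where "C = {x. 0 \<le> T x \<and> T x \<le> 1 \<and> q x \<le> s\<^sup>2}"
    have C_dist: "dist x (a + T x *\<^sub>R E) \<le> s" if "q x \<le> s\<^sup>2" for x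
      using that s(1) unfolding q_def
      by (metis abs_of_nonneg diff_diff_eq dist_norm less_imp_le norm_ge_zero power2_le_imp_le)
    have in_seg: "a + T x *\<^sub>R E \<in> closed_segment a b" if "0 \<le> T x" "T x \<le> 1" for x
      using that unfolding closed_segment_def E_def
      by (auto simp: algebra_simps intro!: exI[of _ "T x"])
    have CD: "C \<subseteq> D"
    proof
      fix x assume x: "x \<in> C"
      then have "x \<in> ball (a + T x *\<^sub>R E) s1" using C_dist[of x] s by (auto simp: C_def dist_commute)
      moreover have "a + T x *\<^sub>R E \<in> closed_segment a b" using in_seg[of x] x by (simp add: C_def)
      ultimately show "x \<in> D" using s1(2) by blast
    qed
    have "closed C" unfolding C_def
      by (intro closed_Collect_conj closed_Collect_le continuous_intros)
    moreover have "bounded C"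
    proof -
      have "bounded (closed_segment a b)" by (rule bounded_closed_segment)
      then obtain N where N: "\<And>p. p \<in> closed_segment a b \<Longrightarrow> norm p \<le> N" unfolding bounded_iff by blast
      have "norm x \<le> N + s" if "x \<in> C" for x
      proof -
        have "norm x \<le> norm (a + T x *\<^sub>R E) + dist x (a + T x *\<^sub>R E)"
          unfolding dist_norm by (metis add.commute norm_triangle_sub)
        then show ?thesis using N[OF in_seg[of x]] C_dist[of x] that by (auto simp: C_def)
      qed
      then show ?thesis unfolding bounded_iff by blast
    qed
    ultimately have C: "compact C" by (simp add: compact_eq_bounded_closed)
    define L where "L x = u a + (u b - u a) * T x" for x
    have uC: "continuous_on C u" using cont CD by (rule continuous_on_subset)
    have "compact ((\<lambda>x. u x - L x) ` C)"
      unfolding L_def by (intro compact_continuous_image continuous_intros uC C)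
    then have "bounded ((\<lambda>x. u x - L x) ` C)" by (rule compact_imp_bounded)
    then obtain K where "\<forall>x\<in>C. \<bar>u x - L x\<bar> \<le> K" unfolding bounded_iff by auto
    then have K: "u x - L x \<le> K" if "x \<in> C" for x using that by fastforce
    \<comment> \<open>Chosen so that \<open>M * q\<close> exceeds \<open>K\<close>, a bound of
      \<open>u - L\<close>, on the lateral surface \<open>q x = s\<^sup>2\<close>.\<close>
    define M where "M = (\<bar>K\<bar> + 1) / s\<^sup>2"
    have M: "M > 0" "M * s\<^sup>2 = \<bar>K\<bar> + 1" using s by (auto simp: M_def)
    \<comment> \<open>The bump \<open>T x * (1 - T x)\<close> is at most 1/4, so
      \<open>u - \<phi>\<close> keeps the value \<open>3 * G / 4\<close> at \<open>x0\<close>, while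
      near the ends of the segment \<open>u\<close> exceeds the end values by at most
      \<open>G / 4\<close>.\<close>
    define \<phi> where "\<phi> x = L x + G * (T x * (1 - T x)) + M * q x" for x
    have q_eq: "q x = (x - a) \<bullet> (x - a) - (E \<bullet> (x - a))\<^sup>2 / (E \<bullet> E)" for x
    proof -
      define h where "h = x - a"
      have T: "T x = (E \<bullet> h) / (E \<bullet> E)" by (simp add: T_def h_def)
      have "q x = h \<bullet> h - 2 * T x * (E \<bullet> h) + (T x)\<^sup>2 * (E \<bullet> E)"
        unfolding q_def power2_norm_eq_inner h_def[symmetric]
        by (simp add: inner_diff_left inner_diff_right inner_commute power2_eq_square algebra_simps)
      also have "\<dots> = h \<bullet> h - (E \<bullet> h)\<^sup>2 / (E \<bullet> E)"
        unfolding T using EE by (simp add: power2_eq_square)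
      finally show ?thesis by (simp add: h_def)
    qed
    \<comment> \<open>The second summand cancels the \<open>M\<close> part of the Hessian in the
      direction \<open>E\<close>; the first leaves \<open>- 2 * G / (E \<bullet> E)\<close>
      there.\<close>
    define \<gamma> where "\<gamma> = - (G / (E \<bullet> E)\<^sup>2 + M / (E \<bullet> E))"
    have \<phi>_eq: "\<phi> = (\<lambda>x. u a + (((u b - u a + G) / (E \<bullet> E)) *\<^sub>R E) \<bullet> (x - a)
        + M * ((x - a) \<bullet> (x - a)) + \<gamma> * (E \<bullet> (x - a))\<^sup>2)"
      unfolding \<phi>_def L_def q_eq T_def \<gamma>_def
      by (rule ext) (simp add: power2_eq_square add_divide_distrib diff_divide_distrib algebra_simps)
    have "continuous_on C (\<lambda>x. u x - \<phi> x)"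
      unfolding \<phi>_def L_def by (intro continuous_intros uC)
    moreover have x0T: "T x0 = t0"
    proof -
      have "x0 - a = t0 *\<^sub>R E" by (simp add: x0_def E_def algebra_simps)
      then show ?thesis using EE by (simp add: T_def)
    qed
    moreover have q0: "q x0 = 0"
      unfolding q_def x0T by (simp add: x0_def E_def algebra_simps)
    moreover have "x0 \<in> C" using t0 x0T q0 by (simp add: C_def)
    ultimately obtain y where y: "y \<in> C" "\<And>x. x \<in> C \<Longrightarrow> u x - \<phi> x \<le> u y - \<phi> y"
      using continuous_attains_sup[OF C, of "\<lambda>x. u x - \<phi> x"] by blast
    have "t0 * (1 - t0) \<le> 1 / 4"
      using zero_le_power2[of "t0 - 1 / 2"] by (simp add: power2_eq_square algebra_simps)
    then have "G * (t0 * (1 - t0)) \<le> G * (1 / 4)" using G by (intro mult_left_mono) auto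
    then have "G * (t0 * (1 - t0)) \<le> G / 4" by simp
    moreover have "u x0 - \<phi> x0 = G - G * (t0 * (1 - t0))"
      unfolding \<phi>_def x0T q0 L_def G_def by (simp add: algebra_simps)
    ultimately have big: "u y - \<phi> y \<ge> 3 * G / 4" using y(2)[OF \<open>x0 \<in> C\<close>] by simp
    have qy: "0 \<le> M * q y" using M(1) by (simp add: q_def)
    \<comment> \<open>The maximum point \<open>y\<close> is kept off the two end faces and the
      lateral surface, so it is a local maximum in the whole space.\<close>
    have "T y \<noteq> 0"
    proof
      assume T: "T y = 0"
      then have "dist y a \<le> s2" using C_dist[of y] y(1) s by (simp add: C_def)
      then have "u y \<le> u a + G / 4" by (rule s2)
      then show False using big G T qy by (simp add: \<phi>_def L_def)
    qed
    moreover have "T y \<noteq> 1"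
    proof
      assume T: "T y = 1"
      then have "dist y b \<le> s3" using C_dist[of y] y(1) s by (simp add: C_def E_def)
      then have "u y \<le> u b + G / 4" by (rule s3)
      then show False using big G T qy by (simp add: \<phi>_def L_def)
    qed
    moreover have "q y \<noteq> s\<^sup>2"
    proof
      assume q: "q y = s\<^sup>2"
      have "0 \<le> T y * (1 - T y)" using y(1) by (simp add: C_def)
      then have "0 \<le> G * (T y * (1 - T y))" using G by simp
      then have "u y - \<phi> y \<le> K - M * s\<^sup>2" using K[OF y(1)] q by (simp add: \<phi>_def)
      then show False using big G M(2) by linarith
    qed
    ultimately have "y \<in> {x. 0 < T x \<and> T x < 1 \<and> q x < s\<^sup>2}" using y(1) by (auto simp: C_def)
    moreover have "open {x. 0 < T x \<and> T x < 1 \<and> q x < s\<^sup>2}"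
      by (intro open_Collect_conj open_Collect_less continuous_intros)
    ultimately have "\<forall>\<^sub>F x in nhds y. x \<in> {x. 0 < T x \<and> T x < 1 \<and> q x < s\<^sup>2}"
      by (rule eventually_nhds_in_open[rotated])
    then have "\<forall>\<^sub>F x in at y. u x - \<phi> x \<le> u y - \<phi> y"
      unfolding eventually_at_filter by eventually_elim (auto intro!: y(2) simp: C_def)
    moreover have "C2_on D \<phi> (\<lambda>_. quad_hess M \<gamma> E)"
      unfolding \<phi>_eq by (rule C2_on_quadratic)
    ultimately have "lambda1 (quad_hess M \<gamma> E) \<ge> 0"
      using sub CD y(1) unfolding viscosity_subsolution_def by force
    moreover have "lambda1 (quad_hess M \<gamma> E) \<le> - (2 * G / (E \<bullet> E))"
    proof -
      define z where "z = (1 / norm E) *\<^sub>R E"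
      have z: "norm z = 1" "z \<bullet> z = 1" "E \<bullet> z = norm E"
        using E by (auto simp: z_def norm_eq_1 power2_norm_eq_inner[symmetric] power2_eq_square)
      have "lambda1 (quad_hess M \<gamma> E) \<le> (quad_hess M \<gamma> E *v z) \<bullet> z" by (rule lambda1_le[OF z(1)])
      also have "\<dots> = 2 * M + 2 * \<gamma> * (E \<bullet> E)"
        unfolding quad_hess_mult
        by (simp add: inner_add_left z power2_norm_eq_inner[symmetric] power2_eq_square)
      also have "\<dots> = - (2 * G / (E \<bullet> E))"
        using E by (simp add: \<gamma>_def power2_eq_square field_simps)
      finally show ?thesis .
    qed
    moreover have "2 * G / (E \<bullet> E) > 0" using G EE by simp
    ultimately show False by linarith
  qed
qed (rule D)

text \<open>Separate the strict epigraph from the point \<open>(y, u y)\<close>. A vertical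
  hyperplane (\<open>\<alpha> = 0\<close>) is impossible since \<open>D\<close> contains a ball
  around \<open>y\<close>, so the separating functional can be normalised by
  \<open>\<alpha>\<close>.\<close>

lemma convex_on_supporting_hyperplane:
  fixes u :: "'a::euclidean_space \<Rightarrow> real"
  assumes u: "convex_on D u" and D: "open D" and y: "y \<in> D"
  obtains v where "\<And>x. x \<in> D \<Longrightarrow> u y + v \<bullet> (x - y) \<le> u x"
proof -
  define E where "E = {(x, t). x \<in> D \<and> u x < t}"
  have cD: "convex D" using u by (simp add: convex_on_def)
  have "convex E"
  proof (rule convexI)
    fix p q :: "'a \<times> real" and a b :: real
    assume pq: "p \<in> E" "q \<in> E" and ab: "0 \<le> a" "0 \<le> b" "a + b = 1"
    obtain x s x' s' where p: "p = (x, s)" "x \<in> D" "u x < s" and q: "q = (x', s')" "x' \<in> D" "u x' < s'"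
      using pq by (auto simp: E_def)
    have "u (a *\<^sub>R x + b *\<^sub>R x') \<le> a * u x + b * u x'"
      using u p q ab by (simp add: convex_on_def)
    also have "\<dots> < a * s + b * s'"
    proof (cases "a = 0")
      case False
      then have "a * u x < a * s" using p ab by simp
      moreover have "b * u x' \<le> b * s'" using q ab by (simp add: mult_left_mono)
      ultimately show ?thesis by linarith
    qed (use q ab in simp)
    finally show "a *\<^sub>R p + b *\<^sub>R q \<in> E"
      using convexD[OF cD p(2) q(2) ab] by (simp add: E_def p q)
  qed
  moreover have "(y, u y + 1) \<in> E" using y by (simp add: E_def)
  then have "E \<noteq> {}" by blast
  moreover have "{(y, u y)} \<inter> E = {}" by (auto simp: E_def)
  ultimately obtain w \<beta> where w: "w \<noteq> 0" "w \<bullet> (y, u y) \<le> \<beta>" "\<And>p. p \<in> E \<Longrightarrow> \<beta> \<le> w \<bullet> p"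
    using separating_hyperplane_sets[of "{(y, u y)}" E] by (metis convex_singleton insertI1 insert_not_empty)
  obtain a \<alpha> where wa: "w = (a, \<alpha>)" by (cases w)
  have *: "a \<bullet> y + \<alpha> * u y \<le> a \<bullet> x + \<alpha> * s" if "x \<in> D" "u x < s" for x s
    using w(2) w(3)[of "(x, s)"] that by (simp add: wa E_def)
  have "\<alpha> \<ge> 0" using *[of y "u y + 1"] y by (simp add: algebra_simps)
  moreover have "\<alpha> \<noteq> 0"
  proof
    assume \<alpha>: "\<alpha> = 0"
    then have a: "a \<noteq> 0" using w(1) by (simp add: wa zero_prod_def)
    obtain e where e: "e > 0" "ball y e \<subseteq> D" using D y open_contains_ball by blast
    define x where "x = y - (e / (2 * norm a)) *\<^sub>R a"
    have "x \<in> D" using e a by (intro subsetD[OF e(2)]) (simp add: x_def dist_norm)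
    then have "a \<bullet> y \<le> a \<bullet> x" using *[of x "u x + 1"] \<alpha> by simp
    then have "(e / (2 * norm a)) * (a \<bullet> a) \<le> 0" by (simp add: x_def inner_diff_right)
    moreover have "(e / (2 * norm a)) * (a \<bullet> a) > 0" using e a by (intro mult_pos_pos) auto
    ultimately show False by linarith
  qed
  ultimately have \<alpha>: "\<alpha> > 0" by simp
  have "u y + (- (1 / \<alpha>) *\<^sub>R a) \<bullet> (x - y) \<le> u x" if "x \<in> D" for x
  proof (rule field_le_epsilon)
    fix e :: real assume "e > 0"
    then have "a \<bullet> y + \<alpha> * u y \<le> a \<bullet> x + \<alpha> * (u x + e)" using *[of x "u x + e"] that by simp
    then have "\<alpha> * (u y + (- (1 / \<alpha>) *\<^sub>R a) \<bullet> (x - y)) \<le> \<alpha> * (u x + e)"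
      using \<alpha> by (simp add: algebra_simps inner_diff_right)
    then show "u y + (- (1 / \<alpha>) *\<^sub>R a) \<bullet> (x - y) \<le> u x + e" using \<alpha> by simp
  qed
  then show ?thesis by (rule that)
qed

lemma compact_strict_gap:
  fixes g :: "'a::metric_space \<Rightarrow> real"
  assumes "compact S" "continuous_on S g" "\<And>x. x \<in> S \<Longrightarrow> 0 < g x"
  obtains c where "c > 0" "\<And>x. x \<in> S \<Longrightarrow> c \<le> g x"
proof (cases "S = {}")
  case True
  then show ?thesis using that[of 1] by simp
next
  case False
  then obtain p where "p \<in> S" "\<And>x. x \<in> S \<Longrightarrow> g p \<le> g x"
    using continuous_attains_inf[OF assms(1) False assms(2)] by blast
  then show ?thesis using that[of "g p"] assms(3) by simp
qed

text \<open>If \<open>y\<close> were not in the convex hull of the contact set on the sphere, one could tilt the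
  supporting plane upwards at \<open>y\<close> and slightly bend it; the result touches \<open>u\<close> from below at an
  interior point of the ball and is strictly convex there.\<close>

lemma supersolution_contact_hull:
  fixes u :: "real^'n \<Rightarrow> real"
  assumes sup: "viscosity_supersolution D u" and cont: "continuous_on D u"
    and R: "0 < R" "cball y R \<subseteq> D"
    and v: "\<And>x. x \<in> D \<Longrightarrow> u y + v \<bullet> (x - y) \<le> u x"
  shows "y \<in> convex hull {x \<in> sphere y R. u x = u y + v \<bullet> (x - y)}"
proof (rule ccontr)
  define Z where "Z = {x \<in> sphere y R. u x = u y + v \<bullet> (x - y)}"
  assume "\<not> ?thesis"
  then have nin: "y \<notin> convex hull Z" by (simp add: Z_def)
  define w where "w x = u x - (u y + v \<bullet> (x - y))" for x
  have SD: "sphere y R \<subseteq> D" using R by auto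
  have wc: "continuous_on (cball y R) w"
    unfolding w_def using continuous_on_subset[OF cont R(2)] by (intro continuous_intros)
  then have wS: "continuous_on (sphere y R) w" by (rule continuous_on_subset) auto
  have w0: "w x \<ge> 0" if "x \<in> D" for x using v[OF that] by (simp add: w_def)
  have "closed Z"
  proof -
    have "Z = sphere y R \<inter> w -` {0}" by (auto simp: Z_def w_def)
    then show ?thesis using continuous_closed_preimage[OF wS closed_sphere, of "{0}"] by simp
  qed
  then have Zc: "compact Z"
    using compact_sphere[of y R] by (metis (no_types, lifting) Z_def compact_Int_closed inf.absorb_iff2 mem_Collect_eq subsetI)
  obtain a b where ab: "a \<bullet> y < b" "\<And>x. x \<in> Z \<Longrightarrow> b < a \<bullet> x"
    using separating_hyperplane_closed_point[OF convex_convex_hull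
        compact_imp_closed[OF compact_convex_hull[OF Zc]] nin] hull_inc[of _ Z convex] by blast
  obtain \<mu> where \<mu>: "\<mu> > 0" "\<And>x. x \<in> Z \<Longrightarrow> \<mu> \<le> a \<bullet> x - b"
    by (rule compact_strict_gap[OF Zc, of "\<lambda>x. a \<bullet> x - b"])
       (use ab in \<open>auto intro!: continuous_intros\<close>)
  \<comment> \<open>The bending term equals \<open>\<mu> / 2\<close> on the sphere, so
    \<open>m\<close> stays negative on the contact set \<open>Z\<close>, while
    \<open>m y = b - a \<bullet> y\<close> is positive.\<close>
  define \<kappa> where "\<kappa> = \<mu> / (2 * R\<^sup>2)"
  have \<kappa>: "\<kappa> > 0" "\<kappa> * R\<^sup>2 = \<mu> / 2" using \<mu> R by (auto simp: \<kappa>_def)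
  define m where "m x = b - a \<bullet> x + \<kappa> * ((x - y) \<bullet> (x - y))" for x
  have mc: "continuous_on S m" for S unfolding m_def by (intro continuous_intros)
  define P where "P = {x \<in> sphere y R. 0 \<le> m x}"
  have sph: "(x - y) \<bullet> (x - y) = R\<^sup>2" if "x \<in> sphere y R" for x
    using that by (simp add: power2_norm_eq_inner[symmetric] dist_norm norm_minus_commute)
  have "closed P"
  proof -
    have "P = sphere y R \<inter> m -` {0..}" by (auto simp: P_def)
    then show ?thesis using continuous_closed_preimage[OF mc closed_sphere, of "{0..}"] by simp
  qed
  then have Pc: "compact P"
    using compact_sphere[of y R] by (metis (no_types, lifting) P_def compact_Int_closed inf.absorb_iff2 mem_Collect_eq subsetI)
  have "w x > 0" if "x \<in> P" for x
  proof -
    have "x \<notin> Z" using that \<mu>(2)[of x] sph[of x] \<kappa> \<mu>(1) by (auto simp: P_def m_def)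
    then have "w x \<noteq> 0" using that by (auto simp: Z_def P_def w_def)
    then show ?thesis using w0[of x] that SD by (force simp: P_def)
  qed
  moreover have "continuous_on P w" using wS by (rule continuous_on_subset) (auto simp: P_def)
  ultimately obtain c where c: "c > 0" "\<And>x. x \<in> P \<Longrightarrow> c \<le> w x"
    using compact_strict_gap[OF Pc, of w] by blast
  obtain N where N: "N > 0" "\<And>x. x \<in> sphere y R \<Longrightarrow> m x < N"
  proof -
    have "bounded (m ` sphere y R)"
      by (intro compact_imp_bounded compact_continuous_image mc compact_sphere)
    then obtain B where "\<forall>x\<in>sphere y R. \<bar>m x\<bar> \<le> B"
      unfolding bounded_iff by auto
    then show thesis using that[of "\<bar>B\<bar> + 1"] by force
  qed
  \<comment> \<open>Where \<open>m\<close> is nonnegative on the sphere, \<open>u\<close> lies at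
    least \<open>c\<close> above the supporting plane, and \<open>\<theta> * m\<close> stays below
    \<open>c\<close>. Hence \<open>h\<close> is nonnegative on the sphere but negative at
    \<open>y\<close>, and its minimum over the ball is interior.\<close>
  define \<theta> where "\<theta> = c / N"
  have \<theta>: "\<theta> > 0" using c N by (simp add: \<theta>_def)
  define h where "h x = w x - \<theta> * m x" for x
  have hS: "h x \<ge> 0" if "x \<in> sphere y R" for x
  proof (cases "x \<in> P")
    case True
    have "\<theta> * m x \<le> \<theta> * N" using N(2)[OF that] \<theta> by simp
    also have "\<dots> = c" using N by (simp add: \<theta>_def)
    also have "\<dots> \<le> w x" by (rule c(2)[OF True])
    finally show ?thesis by (simp add: h_def)
  next
    case False
    then have "m x < 0" using that by (simp add: P_def)
    then have "\<theta> * m x \<le> 0" using \<theta> by (simp add: mult_nonneg_nonpos)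
    then show ?thesis using w0[of x] SD that by (force simp: h_def)
  qed
  have hy: "h y < 0" using \<theta> ab(1) by (simp add: h_def w_def m_def)
  have "continuous_on (cball y R) h" unfolding h_def by (intro continuous_intros wc mc)
  then obtain z where z: "z \<in> cball y R" "\<And>x. x \<in> cball y R \<Longrightarrow> h z \<le> h x"
    using continuous_attains_inf[of "cball y R" h] R by auto
  have "h z < 0" using z(2)[of y] hy R by simp
  then have zb: "z \<in> ball y R" using hS[of z] z(1) by (force simp: less_eq_real_def)
  define \<phi> where "\<phi> x = u x - h x" for x
  have \<phi>: "\<phi> = (\<lambda>x. (u y + \<theta> * (b - a \<bullet> y)) + (v - \<theta> *\<^sub>R a) \<bullet> (x - y)
      + (\<theta> * \<kappa>) * ((x - y) \<bullet> (x - y)) + 0 * (0 \<bullet> (x - y))\<^sup>2)"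
    by (rule ext) (simp add: \<phi>_def h_def w_def m_def inner_diff_left inner_diff_right algebra_simps)
  have "C2_on D \<phi> (\<lambda>_. quad_hess (\<theta> * \<kappa>) 0 0)" unfolding \<phi> by (rule C2_on_quadratic)
  moreover have "\<forall>\<^sub>F x in nhds z. x \<in> ball y R" using zb by (intro eventually_nhds_in_open) auto
  then have "\<forall>\<^sub>F x in at z. u x - \<phi> x \<ge> u z - \<phi> z"
    unfolding eventually_at_filter by eventually_elim (auto simp: \<phi>_def intro!: z(2))
  moreover have "z \<in> D" using z(1) R by blast
  ultimately have "lambda1 (quad_hess (\<theta> * \<kappa>) 0 (0::real^'n)) \<le> 0"
    using sup unfolding viscosity_supersolution_def by force
  moreover have "2 * (\<theta> * \<kappa>) \<le> lambda1 (quad_hess (\<theta> * \<kappa>) 0 (0::real^'n))"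
    by (rule lambda1_ge) (simp add: quad_hess_mult norm_eq_1)
  moreover have "\<theta> * \<kappa> > 0" using \<theta> \<kappa> by simp
  ultimately show False by linarith
qed

text \<open>By Caratheodory's theorem \<open>y\<close> is a convex combination of at most \<open>n + 1\<close> contact points, one
  of which has weight at least \<open>1 / (n + 1)\<close>; \<open>u\<close> is affine on the segment through \<open>y\<close> in its
  direction.\<close>

lemma supersolution_flat_direction:
  fixes u :: "real^'n \<Rightarrow> real"
  assumes sup: "viscosity_supersolution D u" and cont: "continuous_on D u"
    and D: "open D" and u: "convex_on D u" and R: "0 < R" "cball y R \<subseteq> D"
  obtains z where "norm z = 1"
    "\<And>t. 0 \<le> t \<Longrightarrow> t \<le> R / (real CARD('n) + 1) \<Longrightarrow> u (y + t *\<^sub>R z) + u (y - t *\<^sub>R z) \<le> 2 * u y"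
proof -
  have y: "y \<in> D" using R by auto
  obtain v where v: "\<And>x. x \<in> D \<Longrightarrow> u y + v \<bullet> (x - y) \<le> u x"
    using convex_on_supporting_hyperplane[OF u D y] by blast
  define F where "F = {x \<in> D. u x \<le> u y + v \<bullet> (x - y)}"
  have F: "convex F"
  proof (rule convexI)
    fix p q :: "real^'n" and a b :: real
    assume pq: "p \<in> F" "q \<in> F" and ab: "0 \<le> a" "0 \<le> b" "a + b = 1"
    have "u (a *\<^sub>R p + b *\<^sub>R q) \<le> a * u p + b * u q"
      using u pq ab by (simp add: convex_on_def F_def)
    also have "\<dots> \<le> a * (u y + v \<bullet> (p - y)) + b * (u y + v \<bullet> (q - y))"
      using pq ab by (intro add_mono mult_left_mono) (auto simp: F_def)
    also have "\<dots> = (a + b) * (u y - v \<bullet> y) + v \<bullet> (a *\<^sub>R p + b *\<^sub>R q)"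
      by (simp add: algebra_simps inner_add_right inner_diff_right)
    also have "\<dots> = u y + v \<bullet> (a *\<^sub>R p + b *\<^sub>R q - y)"
      by (simp add: ab inner_diff_right)
    finally show "a *\<^sub>R p + b *\<^sub>R q \<in> F"
      using pq ab u by (auto simp: F_def convex_on_def intro!: convexD)
  qed
  have yF: "y \<in> F" using y by (simp add: F_def)
  obtain S where S: "finite S" "S \<subseteq> {x \<in> sphere y R. u x = u y + v \<bullet> (x - y)}"
    "card S \<le> CARD('n) + 1" "y \<in> convex hull S"
    using supersolution_contact_hull[OF sup cont R v] unfolding caratheodory[of "{x \<in> sphere y R. _ x}"]
    by auto
  obtain l where l: "\<And>x. x \<in> S \<Longrightarrow> 0 \<le> l x" "sum l S = 1" "(\<Sum>x\<in>S. l x *\<^sub>R x) = y"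
    using S(4) unfolding convex_hull_finite[OF S(1)] by auto
  have "sphere y R \<subseteq> D" using sphere_cball R(2) by (rule order_trans)
  then have SF: "S \<subseteq> F" using S(2) unfolding F_def by fastforce
  define k where "k = 1 / (real CARD('n) + 1)"
  have "\<exists>p\<in>S. k \<le> l p"
  proof (rule ccontr)
    assume *: "\<not> ?thesis"
    have "S \<noteq> {}" using l(2) by auto
    then have "sum l S < of_nat (card S) * k"
      using * by (intro sum_bounded_above_strict) (auto simp: not_le S card_gt_0_iff)
    also have "\<dots> \<le> (real CARD('n) + 1) * k"
      using S(3) by (intro mult_right_mono) (auto simp: k_def simp flip: of_nat_Suc)
    finally show False using l(2) by (simp add: k_def)
  qed
  then obtain p where p: "p \<in> S" "k \<le> l p" by blast
  have lp: "l p \<le> 1" using l(2) member_le_sum[of p S l] p l(1) S(1) by simp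
  have np: "norm (p - y) = R" using p S(2) by (auto simp: dist_norm norm_minus_commute)
  \<comment> \<open>Exchanging \<open>p\<close> for \<open>y\<close> in the convex combination gives
    a contact point on the far side of \<open>y\<close> from \<open>p\<close>, at distance
    \<open>l p * R\<close>.\<close>
  define y' where "y' = (\<Sum>x\<in>S. l x *\<^sub>R (if x = p then y else x))"
  have "y' \<in> F"
    unfolding y'_def by (rule convex_sum[OF S(1) F l(2,1)]) (use SF yF in auto)
  have "y' - y = y' - (\<Sum>x\<in>S. l x *\<^sub>R x)" by (simp add: l(3))
  also have "\<dots> = (\<Sum>x\<in>S. l x *\<^sub>R ((if x = p then y else x) - x))"
    unfolding y'_def by (simp add: sum_subtractf[symmetric] scaleR_diff_right)
  also have "\<dots> = (\<Sum>x\<in>S. if x = p then l p *\<^sub>R (y - p) else 0)"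
    by (rule sum.cong) auto
  also have "\<dots> = l p *\<^sub>R (y - p)" using p S(1) by simp
  finally have y'_eq: "y' = y - l p *\<^sub>R (p - y)" by (simp add: algebra_simps)
  define z where "z = (1 / R) *\<^sub>R (p - y)"
  have "norm z = 1" using np R by (simp add: z_def)
  moreover have "u (y + t *\<^sub>R z) + u (y - t *\<^sub>R z) \<le> 2 * u y"
    if t: "0 \<le> t" "t \<le> R / (real CARD('n) + 1)" for t
  proof -
    \<comment> \<open>\<open>y + t z\<close> lies at fraction \<open>s\<close> of the way from
      \<open>y\<close> to \<open>p\<close>, and \<open>y - t z\<close> at fraction
      \<open>s / l p\<close> of the way from \<open>y\<close> to \<open>y'\<close>. Both are in the
      convex set \<open>F\<close>, where \<open>u\<close> is at most the supporting plane, and the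
      linear terms cancel in the sum.\<close>
    define s where "s = t / R"
    have "t \<le> k * R" using t by (simp add: k_def)
    then have s: "0 \<le> s" "s \<le> l p" using t R p(2) pos_divide_le_eq[of R t k] by (auto simp: s_def)
    have k: "0 < k" by (simp add: k_def)
    have "y + t *\<^sub>R z = (1 - s) *\<^sub>R y + s *\<^sub>R p" by (simp add: z_def s_def algebra_simps)
    also have "\<dots> \<in> F" using s lp p SF yF by (intro convexD[OF F]) auto
    finally have 1: "y + t *\<^sub>R z \<in> F" .
    have "y - t *\<^sub>R z = (1 - s / l p) *\<^sub>R y + (s / l p) *\<^sub>R y'"
      using p(2) k by (simp add: y'_eq z_def s_def algebra_simps)
    also have "\<dots> \<in> F" using s p(2) k \<open>y' \<in> F\<close> yF by (intro convexD[OF F]) auto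
    finally have 2: "y - t *\<^sub>R z \<in> F" .
    show ?thesis using 1 2 by (simp add: F_def)
  qed
  ultimately show ?thesis by (rule that)
qed

text \<open>On the compact neighbourhood \<open>K2\<close> of radius \<open>2 * d\<close> the
  function is bounded by \<open>M\<close>. Prolonging the segment from \<open>y\<close> to
  \<open>z\<close> by \<open>d\<close> stays in \<open>K2\<close>, and convexity bounds the slope
  from \<open>y\<close> to \<open>z\<close> by the slope over the prolonged segment, at most
  \<open>2 * M / d\<close>.\<close>

lemma convex_on_locally_lipschitz:
  fixes u :: "'a::euclidean_space \<Rightarrow> real"
  assumes u: "convex_on D u" and D: "open D" and K: "compact K" "K \<subseteq> D"
  obtains L \<rho> where "L > 0" "\<rho> > 0" "\<And>x. x \<in> K \<Longrightarrow> cball x \<rho> \<subseteq> D"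
    "\<And>x y z. x \<in> K \<Longrightarrow> y \<in> cball x \<rho> \<Longrightarrow> z \<in> cball x \<rho> \<Longrightarrow> \<bar>u y - u z\<bar> \<le> L * norm (y - z)"
proof -
  obtain e where e: "e > 0" "(\<Union>x\<in>K. ball x e) \<subseteq> D"
    using compact_subset_open_imp_ball_epsilon_subset[OF K(1) D K(2)] by blast
  define d where "d = e / 4"
  have d: "d > 0" "2 * d < e" using e by (auto simp: d_def)
  define K2 where "K2 = (\<Union>x\<in>K. \<Union>y\<in>cball 0 (2 * d). {x + y})"
  have K2: "compact K2" unfolding K2_def by (rule compact_sums'[OF K(1) compact_cball])
  have in_K2: "y \<in> K2" if "x \<in> K" "y \<in> cball x (2 * d)" for x y
    unfolding K2_def using that
    by (intro UN_I[of x] UN_I[of "y - x"]) (auto simp: dist_norm norm_minus_commute)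
  have "K2 \<subseteq> D"
  proof
    fix y assume "y \<in> K2"
    then obtain x q where "x \<in> K" "norm q \<le> 2 * d" "y = x + q" by (auto simp: K2_def)
    then have "y \<in> ball x e" using d by (simp add: dist_norm)
    then show "y \<in> D" using e(2) \<open>x \<in> K\<close> by blast
  qed
  have "continuous_on D u" by (rule convex_on_continuous[OF D u])
  then have "bounded (u ` K2)"
    using \<open>K2 \<subseteq> D\<close> by (intro compact_imp_bounded compact_continuous_image K2)
      (auto intro: continuous_on_subset)
  then obtain M where M: "\<And>x. x \<in> K2 \<Longrightarrow> \<bar>u x\<bar> \<le> M" unfolding bounded_iff by auto
  define L where "L = 2 * \<bar>M\<bar> / d + 1"
  have L: "L > 0" "2 * \<bar>M\<bar> / d \<le> L" using d by (auto simp: L_def add_nonneg_pos)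
  have half: "u z - u y \<le> L * norm (y - z)"
    if x: "x \<in> K" and yz: "y \<in> cball x d" "z \<in> cball x d" for x y z
  proof (cases "y = z")
    case False
    define n where "n = norm (z - y)"
    have n: "n > 0" using False by (simp add: n_def)
    define p where "p = z + (d / n) *\<^sub>R (z - y)"
    define s where "s = n / (n + d)"
    have s: "0 \<le> s" "s \<le> 1" "s \<le> n / d" using n d by (auto simp: s_def divide_simps)
    have "dist z p = d" using n d by (simp add: p_def dist_norm n_def)
    then have "p \<in> cball x (2 * d)" using yz(2) dist_triangle[of x p z] by simp
    then have p: "p \<in> K2" by (rule in_K2[OF x])
    have yK: "y \<in> K2" using in_K2[OF x] yz d by auto
    have "(1 - s) *\<^sub>R y + s *\<^sub>R p = y + (s * (1 + d / n)) *\<^sub>R (z - y)"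
      by (simp add: p_def algebra_simps)
    also have "s * (1 + d / n) = 1"
    proof -
      have "1 + d / n = (n + d) / n" using n by (simp add: field_simps)
      then show ?thesis using n d by (simp add: s_def)
    qed
    finally have "z = (1 - s) *\<^sub>R y + s *\<^sub>R p" by simp
    then have "u z \<le> (1 - s) * u y + s * u p"
      using convex_onD[OF u s(1,2), of y p] p yK \<open>K2 \<subseteq> D\<close> by auto
    then have "u z - u y \<le> s * (u p - u y)" by (simp add: algebra_simps)
    also have "\<dots> \<le> s * (2 * \<bar>M\<bar>)" using M[OF p] M[OF yK] s by (intro mult_left_mono) auto
    also have "\<dots> \<le> (n / d) * (2 * \<bar>M\<bar>)" using s by (intro mult_right_mono) auto
    also have "\<dots> = (2 * \<bar>M\<bar> / d) * n" by simp
    also have "\<dots> \<le> L * n" using L n by (intro mult_right_mono) auto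
    finally show ?thesis by (simp add: n_def norm_minus_commute)
  qed simp
  show ?thesis
  proof (rule that[OF L(1) d(1)])
    show "cball x d \<subseteq> D" if "x \<in> K" for x
      using in_K2[OF that] \<open>K2 \<subseteq> D\<close> d(1) by fastforce
    show "\<bar>u y - u z\<bar> \<le> L * norm (y - z)" if "x \<in> K" "y \<in> cball x d" "z \<in> cball x d" for x y z
      using half[OF that] half[OF that(1,3,2)] by (simp add: abs_le_iff norm_minus_commute)
  qed
qed

section \<open>Boundary values and the dilated solution\<close>

lemma strictly_convex_open_imp_convex:
  assumes "strictly_convex_open D"
  shows "open D" "convex D"
proof -
  show "open D" using assms by (simp add: strictly_convex_open_def)
  show "convex D"
    unfolding convex_contains_open_segment
    using assms closure_subset unfolding strictly_convex_open_def by (metis open_segment_idem empty_subsetI subsetD)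
qed

text \<open>Approach to a frontier point splits into approach from inside \<open>D\<close>, governed
  by the attained boundary values, and along the frontier, governed by the continuity of
  \<open>f\<close>. On a compact closure this yields uniform continuity.\<close>

lemma continuous_on_closure_boundary_values:
  fixes u f :: "'a::t2_space \<Rightarrow> 'b::topological_space"
  assumes D: "open D" and u: "continuous_on D u" and f: "continuous_on (frontier D) f"
    and lim: "\<And>x. x \<in> frontier D \<Longrightarrow> (u \<longlongrightarrow> f x) (at x within D)"
  shows "continuous_on (closure D) (\<lambda>x. if x \<in> D then u x else f x)"
  unfolding continuous_on_def
proof
  let ?w = "\<lambda>x. if x \<in> D then u x else f x"
  fix x assume x: "x \<in> closure D"
  show "(?w \<longlongrightarrow> ?w x) (at x within closure D)"
  proof (cases "x \<in> D")
    case True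
    have "(u \<longlongrightarrow> u x) (at x within D)" using u True by (simp add: continuous_on_def)
    then have "(?w \<longlongrightarrow> u x) (at x within D)"
      by (rule tendsto_cong[THEN iffD1, rotated]) (auto simp: eventually_at_filter)
    moreover have "at x within D = at x within closure D"
      using True D closure_subset by (metis at_within_open at_within_open_subset)
    ultimately show ?thesis using True by simp
  next
    case False
    have cl: "closure D = D \<union> frontier D" by (simp add: closure_Un_frontier)
    have fr: "x \<in> frontier D" "frontier D \<inter> D = {}"
      using x False D by (auto simp: frontier_def interior_open)
    have "(?w \<longlongrightarrow> f x) (at x within D)"
      using lim[OF fr(1)] by (rule tendsto_cong[THEN iffD1, rotated]) (auto simp: eventually_at_filter)
    moreover have "(f \<longlongrightarrow> f x) (at x within frontier D)" using f fr by (simp add: continuous_on_def)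
    then have "(?w \<longlongrightarrow> f x) (at x within frontier D)"
      by (rule tendsto_cong[THEN iffD1, rotated]) (use fr in \<open>auto simp: eventually_at_filter intro!: always_eventually\<close>)
    ultimately show ?thesis using False unfolding cl by (simp add: Lim_within_Un)
  qed
qed

text \<open>The envelope \<open>u\<close> need not be Lipschitz up to the boundary, and its flat segments shrink there.
  Its dilation \<open>g x = u (c + s (x - c))\<close> with \<open>s < 1\<close> close to \<open>1\<close> is defined, Lipschitz and flat on
  segments of a fixed length uniformly near \<open>D\<close>.\<close>

lemma viscosity_solution_approximation:
  fixes D :: "(real^'n) set" and f u :: "real^'n \<Rightarrow> real"
  assumes D: "open D" "convex D" "closure D \<subseteq> box 0 1"
    and f: "continuous_on (cbox 0 1 - D) f" and u: "viscosity_solution D f u" and \<kappa>: "0 < \<kappa>"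
  obtains g :: "real^'n \<Rightarrow> real" and L \<rho> :: real where "0 < L" "0 < \<rho>"
    "\<And>x. x \<in> D \<Longrightarrow> \<bar>g x - u x\<bar> \<le> \<kappa>"
    "\<And>x y. x \<in> cbox 0 1 - D \<Longrightarrow> y \<in> D \<Longrightarrow> dist x y \<le> \<rho> \<Longrightarrow> \<bar>g x - f x\<bar> \<le> \<kappa>"
    "\<And>x y z. x \<in> D \<Longrightarrow> y \<in> cball x \<rho> \<Longrightarrow> z \<in> cball x \<rho> \<Longrightarrow> \<bar>g y - g z\<bar> \<le> L * norm (y - z)"
    "\<And>x y z. x \<in> D \<Longrightarrow> y \<in> cball x \<rho> \<Longrightarrow> z \<in> cball x \<rho> \<Longrightarrow>
      2 * g ((1/2) *\<^sub>R y + (1/2) *\<^sub>R z) \<le> g y + g z"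
    "\<And>x. x \<in> D \<Longrightarrow> \<exists>z. norm z = 1 \<and>
      (\<forall>t. 0 \<le> t \<and> t \<le> \<rho> \<longrightarrow> g (x + t *\<^sub>R z) + g (x - t *\<^sub>R z) \<le> 2 * g x)"
proof (cases "D = {}")
  case True
  then show ?thesis using that[of 1 1] by simp
next
  case False
  then obtain c where c: "c \<in> D" by blast
  have uc: "continuous_on D u" and sub: "viscosity_subsolution D u" and sup: "viscosity_supersolution D u"
    and lim: "\<And>x. x \<in> frontier D \<Longrightarrow> (u \<longlongrightarrow> f x) (at x within D)"
    using u by (auto simp: viscosity_solution_def)
  have conv: "convex_on D u" by (rule subsolution_imp_convex_on[OF D(1,2) uc sub])
  have bdc: "bounded (closure D)" using D(3) bounded_box bounded_subset by blast
  then have cpt: "compact (closure D)" by (simp add: compact_eq_bounded_closed)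
  have fr: "frontier D \<subseteq> cbox 0 1 - D"
    using D box_subset_cbox by (auto simp: frontier_def interior_open)
  define w where "w x = (if x \<in> D then u x else f x)" for x
  have "continuous_on (closure D) w"
    unfolding w_def using continuous_on_closure_boundary_values[OF D(1) uc continuous_on_subset[OF f fr] lim] .
  then have "uniformly_continuous_on (closure D) w" using cpt by (rule compact_uniformly_continuous)
  then obtain e1 where e1: "e1 > 0"
    "\<And>x y. x \<in> closure D \<Longrightarrow> y \<in> closure D \<Longrightarrow> dist y x < e1 \<Longrightarrow> dist (w y) (w x) < \<kappa> / 4"
    unfolding uniformly_continuous_on_def using \<kappa> by (metis zero_less_divide_iff zero_less_numeral)
  have "compact (cbox 0 1 - D)" using D(1) by (simp add: compact_diff)
  then have "uniformly_continuous_on (cbox 0 1 - D) f" using f by (intro compact_uniformly_continuous)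
  then obtain e2 where e2: "e2 > 0"
    "\<And>x y. x \<in> cbox 0 1 - D \<Longrightarrow> y \<in> cbox 0 1 - D \<Longrightarrow> dist y x < e2 \<Longrightarrow> dist (f y) (f x) < \<kappa> / 4"
    unfolding uniformly_continuous_on_def using \<kappa> by (metis zero_less_divide_iff zero_less_numeral)
  obtain N where N: "N > 0" "\<And>x. x \<in> closure D \<Longrightarrow> norm (x - c) \<le> N"
  proof -
    obtain B where "\<forall>x\<in>closure D. norm x \<le> B" using bdc unfolding bounded_iff by blast
    then have "norm (x - c) \<le> \<bar>B\<bar> + norm c + 1" if "x \<in> closure D" for x
      using norm_triangle_ineq4[of x c] that by fastforce
    then show thesis using that[of "\<bar>B\<bar> + norm c + 1"] by (simp add: add_nonneg_pos)
  qed
  \<comment> \<open>The dilation moves points of the closure by at most \<open>e * N\<close>, which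
    stays below the modulus \<open>e1\<close> for the error \<open>\<kappa> / 4\<close>.\<close>
  define e where "e = min (1 / 2) (e1 / (2 * N))"
  have e: "0 < e" "e \<le> 1 / 2" "e * N < e1"
  proof -
    show "0 < e" "e \<le> 1 / 2" using e1(1) N(1) by (auto simp: e_def)
    have "e * N \<le> e1 / (2 * N) * N" using N(1) by (intro mult_right_mono) (auto simp: e_def)
    then show "e * N < e1" using N(1) e1(1) by simp
  qed
  define h where "h x = x - e *\<^sub>R (x - c)" for x
  have h_diff: "h x - h y = (1 - e) *\<^sub>R (x - y)" for x y by (simp add: h_def algebra_simps)
  have h_cball: "h y \<in> cball (h x) d" if "y \<in> cball x d" for x y d
  proof -
    have "norm (h x - h y) \<le> norm (x - y)" unfolding h_diff using e by (simp add: mult_left_le_one_le)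
    then show ?thesis using that by (simp add: dist_norm)
  qed
  define K where "K = h ` closure D"
  have K: "compact K" unfolding K_def h_def by (intro compact_continuous_image cpt continuous_intros)
  have hD: "h x \<in> D" if "x \<in> closure D" for x
    using mem_interior_closure_convex_shrink[OF D(2) _ that, of c e] e c D(1)
    by (simp add: h_def interior_open)
  then have KD: "K \<subseteq> D" by (auto simp: K_def)
  obtain L d where L: "L > 0" and d: "d > 0" "\<And>x. x \<in> K \<Longrightarrow> cball x d \<subseteq> D"
    and lip: "\<And>x y z. x \<in> K \<Longrightarrow> y \<in> cball x d \<Longrightarrow> z \<in> cball x d \<Longrightarrow> \<bar>u y - u z\<bar> \<le> L * norm (y - z)"
    using convex_on_locally_lipschitz[OF conv D(1) K KD] by blast
  \<comment> \<open>The four terms ensure flat segments of length \<open>\<rho>\<close>, the two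
    moduli of continuity, and a Lipschitz error of at most \<open>\<kappa> / 4\<close>.\<close>
  define \<rho> where "\<rho> = min (d / (real CARD('n) + 1)) (min (min (e1 / 2) (e2 / 2)) (\<kappa> / (4 * L)))"
  have \<rho>: "0 < \<rho>" "\<rho> \<le> d / (real CARD('n) + 1)" "\<rho> < e1" "\<rho> < e2" "L * \<rho> \<le> \<kappa> / 4" "\<rho> \<le> d"
  proof -
    show "0 < \<rho>" "\<rho> \<le> d / (real CARD('n) + 1)" "\<rho> < e1" "\<rho> < e2"
      using d(1) e1(1) e2(1) \<kappa> L by (auto simp: \<rho>_def add_nonneg_pos min_less_iff_disj)
    moreover have "d / (real CARD('n) + 1) \<le> d" using d(1) by (simp add: divide_le_eq add_nonneg_pos mult_le_cancel_left1)
    ultimately show "\<rho> \<le> d" by linarith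
    have "L * \<rho> \<le> L * (\<kappa> / (4 * L))" using L by (intro mult_left_mono) (auto simp: \<rho>_def)
    then show "L * \<rho> \<le> \<kappa> / 4" using L by simp
  qed
  define g where "g x = u (h x)" for x
  have hK: "h x \<in> K" if "x \<in> D" for x using that closure_subset by (auto simp: K_def)
  have g_lip: "\<bar>g y - g z\<bar> \<le> L * norm (y - z)" if "x \<in> D" "y \<in> cball x d" "z \<in> cball x d" for x y z
  proof -
    have "\<bar>g y - g z\<bar> \<le> L * norm (h y - h z)"
      unfolding g_def by (rule lip[OF hK h_cball h_cball]) (use that in auto)
    also have "norm (h y - h z) \<le> norm (y - z)"
      unfolding h_diff using e by (simp add: mult_left_le_one_le)
    finally show ?thesis using L by simp
  qed
  have g_u: "\<bar>g x - u x\<bar> \<le> \<kappa> / 4" if "x \<in> D" for x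
  proof -
    have x: "x \<in> closure D" using that closure_subset by blast
    have "dist (h x) x = e * norm (x - c)" using e by (simp add: h_def dist_norm)
    also have "\<dots> \<le> e * N" using N(2)[OF x] e by simp
    finally have "dist (h x) x < e1" using e by simp
    moreover have "h x \<in> closure D" using hD[OF x] closure_subset by blast
    ultimately have "dist (w (h x)) (w x) < \<kappa> / 4" using e1(2) x by blast
    then show ?thesis using hD[OF x] that by (simp add: w_def g_def dist_real_def)
  qed
  show ?thesis
  proof (rule that[of L \<rho> g])
    show "\<bar>g x - u x\<bar> \<le> \<kappa>" if "x \<in> D" for x using g_u[OF that] \<kappa> by simp
    show "\<bar>g y - g z\<bar> \<le> L * norm (y - z)" if "x \<in> D" "y \<in> cball x \<rho>" "z \<in> cball x \<rho>" for x y z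
      using g_lip[of x y z] that \<rho>(6) by simp
    show "2 * g ((1/2) *\<^sub>R y + (1/2) *\<^sub>R z) \<le> g y + g z"
      if "x \<in> D" "y \<in> cball x \<rho>" "z \<in> cball x \<rho>" for x y z
    proof -
      have "h y \<in> D" "h z \<in> D"
        using d(2)[OF hK[OF that(1)]] h_cball[of y x d] h_cball[of z x d] that \<rho>(6) by auto
      then have "u ((1 - 1/2) *\<^sub>R h y + (1/2) *\<^sub>R h z) \<le> (1 - 1/2) * u (h y) + (1/2) * u (h z)"
        by (intro convex_onD[OF conv]) auto
      moreover have "(1 - 1/2) *\<^sub>R h y + (1/2) *\<^sub>R h z = h ((1/2) *\<^sub>R y + (1/2) *\<^sub>R z)"
      proof -
        have "c = (1/2) *\<^sub>R c + (1/2) *\<^sub>R c" by (simp flip: scaleR_left_distrib)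
        then have "(1/2) *\<^sub>R (e *\<^sub>R c) + (1/2) *\<^sub>R (e *\<^sub>R c) = e *\<^sub>R c"
          by (metis scaleR_left_commute scaleR_right_distrib)
        then show ?thesis by (simp add: h_def algebra_simps)
      qed
      ultimately show ?thesis by (simp add: g_def)
    qed
    show "\<exists>z. norm z = 1 \<and>
      (\<forall>t. 0 \<le> t \<and> t \<le> \<rho> \<longrightarrow> g (x + t *\<^sub>R z) + g (x - t *\<^sub>R z) \<le> 2 * g x)" if x: "x \<in> D" for x
    proof -
      obtain z where z: "norm z = 1" "\<And>t. 0 \<le> t \<Longrightarrow> t \<le> d / (real CARD('n) + 1) \<Longrightarrow>
          u (h x + t *\<^sub>R z) + u (h x - t *\<^sub>R z) \<le> 2 * u (h x)"
        using supersolution_flat_direction[OF sup uc D(1) conv d(1) d(2)[OF hK[OF x]]] by blast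
      have "g (x + t *\<^sub>R z) + g (x - t *\<^sub>R z) \<le> 2 * g x" if "0 \<le> t" "t \<le> \<rho>" for t
      proof -
        have "(1 - e) * t \<le> t" "0 \<le> (1 - e) * t" using that e by (auto simp: mult_left_le_one_le)
        then have "u (h x + ((1 - e) * t) *\<^sub>R z) + u (h x - ((1 - e) * t) *\<^sub>R z) \<le> 2 * u (h x)"
          using \<rho>(2) that by (intro z(2)) auto
        moreover have "h (x + t *\<^sub>R z) = h x + ((1 - e) * t) *\<^sub>R z" "h (x - t *\<^sub>R z) = h x - ((1 - e) * t) *\<^sub>R z"
          by (simp_all add: h_def algebra_simps)
        ultimately show ?thesis by (simp add: g_def)
      qed
      then show ?thesis using z(1) by blast
    qed
    show "\<bar>g x - f x\<bar> \<le> \<kappa>" if x: "x \<in> cbox 0 1 - D" and y: "y \<in> D" and xy: "dist x y \<le> \<rho>" for x y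
    proof -
      \<comment> \<open>A crossing point \<open>p\<close> of the frontier links inside and outside:
        the passages from \<open>g x\<close> to \<open>g y\<close>, \<open>u y\<close>,
        \<open>f p\<close> and \<open>f x\<close> cost \<open>\<kappa> / 4\<close> each.\<close>
      have "closed_segment y x \<inter> frontier D \<noteq> {}"
        by (rule connected_Int_frontier) (use x y in auto)
      then obtain p where p: "p \<in> closed_segment y x" "p \<in> frontier D" by blast
      have pd: "dist p y \<le> \<rho>" "dist p x \<le> \<rho>"
        using dist_in_closed_segment[OF p(1)] xy by (auto simp: dist_commute)
      have "\<bar>g x - g y\<bar> \<le> L * norm (x - y)"
        by (rule g_lip[OF y]) (use xy \<rho> d in \<open>auto simp: dist_commute\<close>)
      also have "\<dots> \<le> L * \<rho>" using xy L by (simp add: dist_norm)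
      finally have 1: "\<bar>g x - g y\<bar> \<le> \<kappa> / 4" using \<rho> by simp
      have "dist (w p) (w y) < \<kappa> / 4"
        using p(2) y closure_subset pd \<rho> by (intro e1(2)) (auto simp: frontier_def)
      moreover have "p \<notin> D" using p(2) fr by blast
      ultimately have 2: "\<bar>f p - u y\<bar> \<le> \<kappa> / 4" using y by (simp add: w_def dist_real_def)
      have "dist (f p) (f x) < \<kappa> / 4"
        using p(2) fr x pd \<rho> by (intro e2(2)) auto
      then have 3: "\<bar>f p - f x\<bar> \<le> \<kappa> / 4" by (simp add: dist_real_def)
      show ?thesis using 1 2 3 g_u[OF y] by linarith
    qed
  qed (use L \<rho> in auto)
qed

section \<open>Convergence of the game values\<close>

theorem theorem2:
  fixes D :: "(real^'n::{finite,linorder}) set"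
    and f u :: "real^'n::_ \<Rightarrow> real"
    and r \<delta> :: "nat \<Rightarrow> real"
  assumes "CARD('n) \<ge> 2"
    and "strictly_convex_open D"
    and "closure D \<subseteq> box 0 1"
    and "continuous_on (cbox 0 1 - D) f"
    and "\<And>n. r n > 0"
    and "decseq r"
    and "r \<longlonglongrightarrow> 0"
    and "filterlim (\<lambda>n. sqrt (real n) * r n ^ (2 * CARD('n)) / ln (real n)) at_top sequentially"
    and "\<And>n. \<delta> n = r n / sqrt (ln (real n))"
    and "viscosity_solution D f u"
  shows "AE X in sample_space.
           uniform_limit D (\<lambda>n. extended_value D f (vertices X n) (r n) (\<delta> n)) u sequentially"
  using AE_eventually_eps_dense[OF assms(5,7,8)]
proof eventually_elim
  \<comment> \<open>From here \<open>X\<close> is a fixed sequence whose vertices eventually become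
    dense; the exceptional null set does not depend on the tolerance \<open>e\<close> chosen
    below.\<close>
  case (elim X)
  note D = strictly_convex_open_imp_convex[OF assms(2)]
  have "bounded (closure D)" using assms(3) bounded_box bounded_subset by blast
  then have "compact (closure D)" by (simp add: compact_eq_bounded_closed)
  then obtain s where s: "s > 0" "(\<Union>x\<in>closure D. ball x s) \<subseteq> box 0 1"
    using compact_subset_open_imp_ball_epsilon_subset[OF _ open_box assms(3)] by blast
  show ?case
    unfolding uniform_limit_iff
  proof (intro allI impI)
    fix e :: real assume "e > 0"
    define \<kappa> where "\<kappa> = e / 5"
    have \<kappa>: "\<kappa> > 0" "4 * \<kappa> < e" using \<open>e > 0\<close> by (auto simp: \<kappa>_def)
    obtain g :: "real^'n::_ \<Rightarrow> real" and L \<rho> where L: "0 < L" and \<rho>: "0 < \<rho>"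
      and g: "\<And>x. x \<in> D \<Longrightarrow> \<bar>g x - u x\<bar> \<le> \<kappa>"
        "\<And>x y. x \<in> cbox 0 1 - D \<Longrightarrow> y \<in> D \<Longrightarrow> dist x y \<le> \<rho> \<Longrightarrow> \<bar>g x - f x\<bar> \<le> \<kappa>"
        "\<And>x y z. x \<in> D \<Longrightarrow> y \<in> cball x \<rho> \<Longrightarrow> z \<in> cball x \<rho> \<Longrightarrow> \<bar>g y - g z\<bar> \<le> L * norm (y - z)"
        "\<And>x y z. x \<in> D \<Longrightarrow> y \<in> cball x \<rho> \<Longrightarrow> z \<in> cball x \<rho> \<Longrightarrow>
          2 * g ((1/2) *\<^sub>R y + (1/2) *\<^sub>R z) \<le> g y + g z"
        "\<And>x. x \<in> D \<Longrightarrow> \<exists>z. norm z = 1 \<and>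
          (\<forall>t. 0 \<le> t \<and> t \<le> \<rho> \<longrightarrow> g (x + t *\<^sub>R z) + g (x - t *\<^sub>R z) \<le> 2 * g x)"
      by (rule viscosity_solution_approximation[OF D assms(3,4,10) \<kappa>(1)]) (rule that; assumption)
    define N where "N = real CARD('n)"
    have N: "1 \<le> N" by (simp add: N_def Suc_le_eq)
    have "\<forall>\<^sub>F n in sequentially. r n < min (1 / 2) (min \<rho> s)"
      using assms(7) \<rho> s(1) by (intro order_tendstoD(2)) auto
    \<comment> \<open>With \<open>\<epsilon> = N * (r n)\<^sup>2 / l\<close> and
      \<open>l = ln n\<close>, the requirements
      \<open>4 * \<epsilon> \<le> \<delta> n * r n\<close>,
      \<open>24 * N * \<epsilon> \<le> (r n)\<^sup>2\<close> and \<open>72 * L * \<epsilon> *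
      N\<^sup>2 \<le> \<kappa> * (r n)\<^sup>2\<close> become \<open>16 * N\<^sup>2 \<le> l\<close>,
      \<open>24 * N\<^sup>2 \<le> l\<close> and
      \<open>72 * L * N ^ 3 / \<kappa> \<le> l\<close>.\<close>
    moreover have "\<forall>\<^sub>F n in sequentially. 24 * N\<^sup>2 + 72 * L * N ^ 3 / \<kappa> \<le> ln (real n)"
      using filterlim_ln_nat unfolding filterlim_at_top by blast
    ultimately show "\<forall>\<^sub>F n in sequentially. \<forall>x\<in>D.
        dist (extended_value D f (vertices X n) (r n) (\<delta> n) x) (u x) < e"
      using elim
    proof eventually_elim
      case (elim n)
      define l where "l = ln (real n)"
      have "1 \<le> N\<^sup>2" using N by simp
      moreover have "0 \<le> 72 * L * N ^ 3 / \<kappa>" using L N \<kappa> by simp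
      ultimately have l: "1 \<le> l" "16 * N\<^sup>2 \<le> l" "24 * N\<^sup>2 \<le> l" "72 * L * N ^ 3 / \<kappa> \<le> l"
        using elim(2) unfolding l_def by linarith+
      define \<epsilon> where "\<epsilon> = N * (r n)\<^sup>2 / l"
      have r: "0 < r n" "r n \<le> 1 / 2" "r n \<le> \<rho>" "r n < s" using elim assms(5) by auto
      have dense: "eps_dense \<epsilon> (vertices X n)" using elim(3) by (simp add: \<epsilon>_def N_def l_def)
      have \<delta>: "\<delta> n = r n / sqrt l" using assms(9) by (simp add: l_def)
      have "\<bar>extended_value D f (vertices X n) (r n) (\<delta> n) x - u x\<bar> \<le> 4 * \<kappa>" if x: "x \<in> D" for x
      proof (rule extended_value_near[OF dense _ _ _ r(1-3) _ _ \<kappa>(1) L _ g x, folded N_def])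
        have "4 * N = sqrt (16 * N\<^sup>2)" using N by (simp add: real_sqrt_mult)
        also have "\<dots> \<le> sqrt l" using l by simp
        finally have "4 * N * (r n)\<^sup>2 / l \<le> sqrt l * (r n)\<^sup>2 / l"
          using l by (intro divide_right_mono mult_right_mono) auto
        also have "\<dots> = (r n)\<^sup>2 / sqrt l" using l by (simp add: real_div_sqrt field_simps)
        finally show "4 * \<epsilon> \<le> \<delta> n * r n" by (simp add: \<epsilon>_def \<delta> power2_eq_square)
        have "r n / sqrt l \<le> r n / 1" using l r by (intro divide_left_mono) auto
        then have "\<delta> n \<le> r n" by (simp add: \<delta>)
        then show "\<delta> n \<le> 1 / 2" using r by linarith
        show "0 < \<epsilon>" using N l r by (simp add: \<epsilon>_def)
        have "24 * N * \<epsilon> = (24 * N\<^sup>2) * ((r n)\<^sup>2 / l)" by (simp add: \<epsilon>_def power2_eq_square)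
        also have "\<dots> \<le> l * ((r n)\<^sup>2 / l)" using l by (intro mult_right_mono) auto
        finally show "24 * N * \<epsilon> \<le> (r n)\<^sup>2" using l by simp
        have "72 * L * N ^ 3 \<le> \<kappa> * l" using l(4) \<kappa> by (simp add: pos_divide_le_eq mult.commute)
        then have "(72 * L * N ^ 3) * ((r n)\<^sup>2 / l) \<le> (\<kappa> * l) * ((r n)\<^sup>2 / l)"
          using l by (intro mult_right_mono) auto
        then show "72 * L * \<epsilon> * N\<^sup>2 \<le> \<kappa> * (r n)\<^sup>2"
          using l by (simp add: \<epsilon>_def power3_eq_cube power2_eq_square mult_ac)
        fix y assume "y \<in> D"
        then have "ball y s \<subseteq> box 0 1" using s(2) closure_subset by blast
        moreover have "cball y (r n) \<subseteq> ball y s" using r by auto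
        ultimately show "cball y (r n) \<subseteq> cbox 0 1" using box_subset_cbox by blast
      qed
      then show ?case using \<kappa>(2) by (fastforce simp: dist_real_def)
    qed
  qed
qed

end
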